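(* Let $r\ge1$ be an integer and $\alpha=\frac{\epsilon\pi}{2r}$ with $0<\epsilon<\frac12$. For $\mu>0$, let $H^\mu=W-\mu V_\alpha$ be the spherical harmonic of degree $2r$ on $\mathbb{S}^2$ given in spherical coordinates by $$h^\mu(\vartheta,\varphi)=\sin^{2r}(\vartheta)\sin(2r\varphi)+\mu\,\sin\vartheta\,P'_{2r}(\cos\vartheta)\,\sin(\varphi-\alpha).$$ Then $H^\mu$ has no critical zero, except when $\mu$ is one of the finitely many values $\mu_{i,j}(\alpha)$, $1\le i\le r-1$, $1\le j\le 2r-1$. For each value $\mu=\mu_{i,j}(\alpha)$, the spherical harmonic $H^\mu$ has finitely many critical zeros. Define $\mu_c(\alpha,2r)=\inf\mu_{i,j}(\alpha)$, the infimum being taken over $1\le i\le r-1$ and $1\le j\le 2r-1$. Then, for $0<\mu<\mu_c(\alpha,2r)$, the function $H^\mu$ has no critical zero, so that its nodal set $N(H^\mu)$ consists of finitely many disjoint simple closed curves.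
   Context: $\mathbb{S}^2\subset\mathbb{R}^3$ is the unit sphere. Spherical coordinates are $E(\vartheta,\varphi)=(\sin\vartheta\cos\varphi,\sin\vartheta\sin\varphi,\cos\vartheta)$, $\vartheta\in[0,\pi]$, $\varphi\in\mathbb{R}/2\pi\mathbb{Z}$. The nodal set $N(u)$ of a function $u$ on $\mathbb{S}^2$ is its zero set. A critical zero of $u$ is a point of $\mathbb{S}^2$ at which both $u$ and its differential $du$ vanish. $P_{\ell}(t)=\frac{1}{2^{\ell}\ell!}\frac{d^{\ell}}{dt^{\ell}}(t^2-1)^{\ell}$ is the Legendre polynomial. $W$ is the restriction to $\mathbb{S}^2$ of $\mathrm{Im}\,(x+iy)^{2r}$, i.e. $\sin^{2r}(\vartheta)\sin(2r\varphi)$; $V_\alpha$ is the spherical harmonic of degree $2r$ given by $-\sin\vartheta\,P'_{2r}(\cos\vartheta)\sin(\varphi-\alpha)$. The polynomial $2rP_{2r}(t)-tP'_{2r}(t)$ has exactly $r-1$ zeros in $(0,1)$; write them as $\cos\omega_1>\cdots>\cos\omega_{r-1}$ with $0<\omega_1<\cdots<\omega_{r-1}<\frac{\pi}{2}$. The function $f(\varphi)=2r\cos(2r\varphi)\sin(\varphi-\alpha)-\sin(2r\varphi)\cos(\varphi-\alpha)$ has, for each $1\le j\le 2r-1$, exactly one zero $\varphi_j$ in $\left(\frac{j\pi}{2r},\frac{(j+1)\pi}{2r}\right)$. For $1\le i\le r-1$ and $1\le j\le 2r-1$ set $$\mu_{i,j}(\alpha)=\left|\frac{\sin^{2r-1}(\omega_i)\,\sin(2r\varphi_j)}{P'_{2r}(\cos\omega_i)\,\sin(\varphi_j-\alpha)}\right|$$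 (the denominators do not vanish). For $r=1$ there are no values $\mu_{i,j}(\alpha)$ and $\mu_c(\alpha,2)=+\infty$. *)

theory Defs
  imports "HOL-Analysis.Analysis" "HOL-Computational_Algebra.Polynomial"
begin

abbreviation S2 :: "(real^3) set" where
  "S2 \<equiv> sphere 0 1"

definition sph :: "real \<Rightarrow> real \<Rightarrow> real^3" where
  "sph \<theta> \<phi> = vector [sin \<theta> * cos \<phi>, sin \<theta> * sin \<phi>, cos \<theta>]"

text \<open>Functions on the sphere are represented by functions on \<open>real^3\<close>; the notions
  below only depend on the values on \<open>S2\<close>.\<close>

definition nodal_set :: "(real^3 \<Rightarrow> real) \<Rightarrow> (real^3) set" where
  "nodal_set u = {p \<in> S2. u p = 0}"

text \<open>A derivative \<open>D\<close> within \<open>S2\<close> is determined only on the tangent plane, i.e. on the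
  vectors orthogonal to \<open>p\<close>; its restriction to that plane is the differential of the
  restriction of \<open>u\<close> to the sphere.\<close>

definition critical_zero :: "(real^3 \<Rightarrow> real) \<Rightarrow> real^3 \<Rightarrow> bool" where
  "critical_zero u p \<longleftrightarrow> p \<in> S2 \<and> u p = 0 \<and>
     (\<exists>D. (u has_derivative D) (at p within S2) \<and> (\<forall>v. p \<bullet> v = 0 \<longrightarrow> D v = 0))"

definition simple_closed_curve :: "(real^3) set \<Rightarrow> bool" where
  "simple_closed_curve C \<longleftrightarrow>
     (\<exists>g. simple_path g \<and> pathfinish g = pathstart g \<and> path_image g = C)"

definition legendre_poly :: "nat \<Rightarrow> real poly" where
  "legendre_poly l = smult (1 / (2 ^ l * fact l)) ((pderiv ^^ l) ([:-1, 0, 1:] ^ l))"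

definition W :: "nat \<Rightarrow> real^3 \<Rightarrow> real" where
  "W r p = Im (Complex (p $ 1) (p $ 2) ^ (2 * r))"

text \<open>On the sphere, \<open>sin \<theta> * sin (\<phi> - \<alpha>)\<close> is \<open>y * cos \<alpha> - x * sin \<alpha>\<close>; see \<open>V_sph\<close> below.\<close>

definition V :: "nat \<Rightarrow> real \<Rightarrow> real^3 \<Rightarrow> real" where
  "V r \<alpha> p = - ((p $ 2) * cos \<alpha> - (p $ 1) * sin \<alpha>) * poly (pderiv (legendre_poly (2 * r))) (p $ 3)"

definition H :: "nat \<Rightarrow> real \<Rightarrow> real \<Rightarrow> real^3 \<Rightarrow> real" where
  "H r \<alpha> \<mu> p = W r p - \<mu> * V r \<alpha> p"

lemma sph_nth [simp]:
  "sph \<theta> \<phi> $ 1 = sin \<theta> * cos \<phi>" "sph \<theta> \<phi> $ 2 = sin \<theta> * sin \<phi>" "sph \<theta> \<phi> $ 3 = cos \<theta>"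
  by (simp_all add: sph_def)

lemma W_sph: "W r (sph \<theta> \<phi>) = sin \<theta> ^ (2 * r) * sin (2 * real r * \<phi>)"
proof -
  have "Complex (sin \<theta> * cos \<phi>) (sin \<theta> * sin \<phi>) = complex_of_real (sin \<theta>) * cis \<phi>"
    by (simp add: complex_eq_iff)
  moreover have "cis \<phi> ^ (2 * r) = cis (2 * real r * \<phi>)"
    by (simp add: Complex.DeMoivre)
  ultimately show ?thesis
    by (simp add: W_def power_mult_distrib flip: of_real_power)
qed

lemma V_sph:
  "V r \<alpha> (sph \<theta> \<phi>) = - sin \<theta> * poly (pderiv (legendre_poly (2 * r))) (cos \<theta>) * sin (\<phi> - \<alpha>)"
  by (simp add: V_def sin_diff algebra_simps)

lemma H_sph:
  "H r \<alpha> \<mu> (sph \<theta> \<phi>) = sin \<theta> ^ (2 * r) * sin (2 * real r * \<phi>)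
     + \<mu> * sin \<theta> * poly (pderiv (legendre_poly (2 * r))) (cos \<theta>) * sin (\<phi> - \<alpha>)"
  by (simp add: H_def W_sph V_sph)

text \<open>The zeros in \<open>(0,1)\<close> are listed in decreasing order, so that \<open>omega r i\<close> increases
  with \<open>i = 1, \<dots>, r - 1\<close>.\<close>

definition omega :: "nat \<Rightarrow> nat \<Rightarrow> real" where
  "omega r i = arccos (rev (sorted_list_of_set
     {t. 0 < t \<and> t < 1 \<and> 2 * real r * poly (legendre_poly (2 * r)) t
                       - t * poly (pderiv (legendre_poly (2 * r))) t = 0}) ! (i - 1))"

definition phi :: "nat \<Rightarrow> real \<Rightarrow> nat \<Rightarrow> real" where
  "phi r \<alpha> j = (THE \<phi>. real j * pi / (2 * real r) < \<phi> \<and> \<phi> < real (j + 1) * pi / (2 * real r) \<and>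
     2 * real r * cos (2 * real r * \<phi>) * sin (\<phi> - \<alpha>) - sin (2 * real r * \<phi>) * cos (\<phi> - \<alpha>) = 0)"

definition mu :: "nat \<Rightarrow> real \<Rightarrow> nat \<Rightarrow> nat \<Rightarrow> real" where
  "mu r \<alpha> i j = \<bar>(sin (omega r i) ^ (2 * r - 1) * sin (2 * real r * phi r \<alpha> j)) /
     (poly (pderiv (legendre_poly (2 * r))) (cos (omega r i)) * sin (phi r \<alpha> j - \<alpha>))\<bar>"

text \<open>The infimum is taken in the extended reals, hence is \<open>\<infinity>\<close> if \<open>r = 1\<close>.\<close>

definition mu_c :: "nat \<Rightarrow> real \<Rightarrow> ereal" where
  "mu_c r \<alpha> = (INF i\<in>{1..r - 1}. INF j\<in>{1..2 * r - 1}. ereal (mu r \<alpha> i j))"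

end

theory Submission imports Defs begin

text \<open>Away from the poles, which are never critical, dividing the function by \<open>sin \<theta>\<close> and
  eliminating \<open>\<mu>\<close> from the three equations for a critical zero separates the variables: \<open>\<phi>\<close> must be
  a zero of \<open>f\<close> and, by the Legendre equation, \<open>cos \<theta>\<close> a zero of \<open>2 r P - t P'\<close>. The
  remaining equation then determines \<open>\<bar>\<mu>\<bar>\<close>, and its sign is adjusted by replacing \<open>\<theta>\<close> with
  \<open>\<pi> - \<theta>\<close>, because \<open>P'\<close> is odd. Without critical zeros, the nodal set is locally an arc by the
  inverse function theorem, and a compact set which is locally an arc is cut into finitely many arcs
  of which exactly two meet at every end point; joining them one by one gives closed curves.\<close>

section \<open>Compact one-dimensional manifolds\<close>

text \<open>Away from the poles and from zeros of the denominators, a zero of \<open>H\<close>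
  satisfies \<open>A B = - \<mu>\<close> with
  \<open>A = sin \<theta> ^ (2 * r - 1) / P'(cos \<theta>)\<close> and
  \<open>B = sin (2 * r * \<phi>) / sin (\<phi> - \<alpha>)\<close>. A critical zero is then a
  critical point of the product at a nonzero level, so both \<open>A'\<close> and \<open>B'\<close>
  vanish. The numerator of \<open>B'\<close> is \<open>f\<close>; that of \<open>A'\<close> contains
  \<open>P''\<close>, and Legendre's equation turns it into a multiple of
  \<open>2 r P - t P'\<close>. The numbers \<open>mu r \<alpha> i j\<close> are thus the absolute
  critical values of \<open>A B\<close>. The computation is done without quotients, because points
  with \<open>sin (\<phi> - \<alpha>) = 0\<close> have to be treated too. They are excluded by the
  choice of \<open>\<alpha>\<close>: \<open>f\<close> does not vanish there, since
  \<open>2 * r * \<alpha>\<close> lies strictly between \<open>0\<close> and \<open>pi\<close>. The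
  candidate angles do not depend on \<open>\<mu>\<close>, which makes the critical zeros finite in
  number for every positive \<open>\<mu>\<close>. For the nodal curves there is no global
  parametrisation to write down, so closed curves have to be assembled combinatorially from local
  arcs.\<close>

definition path_ends :: "(real \<Rightarrow> 'a::topological_space) \<Rightarrow> 'a set" where
  "path_ends g = {pathstart g, pathfinish g}"

section \<open>Graphs of arcs in which every vertex has degree two\<close>

lemma arc_midpoint_not_end:
  assumes "arc g"
  shows "g (1/2) \<in> path_image g" "g (1/2) \<notin> path_ends g"
proof -
  have inj: "inj_on g {0..1}" using assms by (simp add: arc_def)
  show "g (1/2) \<in> path_image g" by (simp add: path_image_def)
  have "g (1/2) \<noteq> g 0" "g (1/2) \<noteq> g 1"
    using inj_onD[OF inj, of "1/2" 0] inj_onD[OF inj, of "1/2" 1] by auto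
  then show "g (1/2) \<notin> path_ends g" by (simp add: path_ends_def pathstart_def pathfinish_def)
qed

text \<open>Induction on the number of arcs. The two arcs at a vertex \<open>e\<close> are joined,
  which removes \<open>e\<close> from the graph. If their other ends differ, the join is an arc and
  all remaining degrees are unchanged; if they agree, the join is a closed curve that can be split
  off, since its vertices have no further arcs.\<close>

theorem two_regular_arc_graph_closed_curves:
  fixes G :: "(real \<Rightarrow> real^3) set"
  assumes "finite G" "\<And>g. g \<in> G \<Longrightarrow> arc g"
    and "\<And>g h. g \<in> G \<Longrightarrow> h \<in> G \<Longrightarrow> g \<noteq> h \<Longrightarrow> path_image g \<inter> path_image h \<subseteq> path_ends g \<inter> path_ends h"
    and "\<And>g e. g \<in> G \<Longrightarrow> e \<in> path_ends g \<Longrightarrow> card {h \<in> G. e \<in> path_ends h} = 2"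
  shows "\<exists>\<C>. finite \<C> \<and> disjoint \<C> \<and> (\<forall>C\<in>\<C>. simple_closed_curve C) \<and> \<Union>(path_image ` G) = \<Union>\<C>"
  using assms
proof (induction "card G" arbitrary: G rule: less_induct)
  case less
  note fin = \<open>finite G\<close> and arcs = less.prems(2) and meet = less.prems(3) and two = less.prems(4)
  show ?case
  proof (cases "G = {}")
    case True
    then show ?thesis by (intro exI[of _ "{}"]) (auto simp: disjoint_def)
  next
    case False
    then obtain g where g: "g \<in> G" by auto
    define a e where "a = pathstart g" and "e = pathfinish g"
    have "card {h \<in> G. e \<in> path_ends h} = 2" using two[OF g, of e] by (simp add: e_def path_ends_def)
    then obtain x y where xy: "{k \<in> G. e \<in> path_ends k} = {x, y}" "x \<noteq> y"
      by (meson card_2_iff)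
    moreover have "g \<in> {k \<in> G. e \<in> path_ends k}" using g by (simp add: e_def path_ends_def)
    ultimately obtain h where h: "{k \<in> G. e \<in> path_ends k} = {g, h}" "h \<noteq> g"
      by (metis empty_iff insert_commute insert_iff)
    then have hG: "h \<in> G" and eh: "e \<in> path_ends h" by blast+
    define h' where "h' = (if pathstart h = e then h else reversepath h)"
    have h': "arc h'" "path_image h' = path_image h" "path_ends h' = path_ends h" "pathstart h' = e"
      using arcs[OF hG] eh by (auto simp: h'_def arc_reversepath path_ends_def)
    define b where "b = pathfinish h'"
    have eds: "path_ends g = {a, e}" "path_ends h = {e, b}"
      using h' by (auto simp: a_def e_def b_def path_ends_def)
    have ne: "a \<noteq> e" "b \<noteq> e"
      using arc_distinct_ends[OF arcs[OF g]] arc_distinct_ends[OF h'(1)] h'(4)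
      by (auto simp: a_def e_def b_def)
    define G0 where "G0 = G - {g, h}"
    define c where "c = g +++ h'"
    have img: "path_image c = path_image g \<union> path_image h"
      using h' by (simp add: c_def path_image_join e_def)
    have gh: "path_image g \<inter> path_image h \<subseteq> {a, e} \<inter> {e, b}"
      using meet[OF g hG] h(2) eds by auto
    have enot: "e \<notin> path_ends k" if "k \<in> G0" for k
      using that h(1) unfolding G0_def by blast
    have cardG0: "card G = Suc (Suc (card G0))"
      using card_mono[of G "{g, h}"] fin g hG h(2)
      unfolding G0_def by (simp add: card_Diff_subset)
    have finG0: "finite G0" using fin by (simp add: G0_def)
    have U: "\<Union>(path_image ` G) = path_image c \<union> \<Union>(path_image ` G0)"
      using g hG img unfolding G0_def by auto
    show ?thesis
    proof (cases "a = b")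
      case True
      have "simple_path c"
        unfolding c_def
        by (rule simple_path_join_loop) (use h' arcs[OF g] gh True eds in \<open>auto simp: a_def e_def b_def\<close>)
      then have scc: "simple_closed_curve (path_image c)"
        unfolding simple_closed_curve_def using h' True
        by (intro exI[of _ c]) (auto simp: c_def a_def b_def)
      \<comment> \<open>The degree of \<open>a\<close> is used up by \<open>g\<close> and
        \<open>h\<close>, so no remaining arc touches the closed curve.\<close>
      have "card {k \<in> G. a \<in> path_ends k} = 2" using two[OF g, of a] by (simp add: a_def path_ends_def)
      then have "{k \<in> G. a \<in> path_ends k} = {g, h}"
        using g hG h(2) eds True
        by (intro card_seteq[symmetric]) (auto simp: fin)
      then have anot: "a \<notin> path_ends k" if "k \<in> G0" for k
        using that unfolding G0_def by blast
      have same: "{m \<in> G0. x \<in> path_ends m} = {m \<in> G. x \<in> path_ends m}"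
        if "k \<in> G0" "x \<in> path_ends k" for k x
      proof -
        have "x \<notin> {a, e}" using that enot anot by blast
        then have "x \<notin> path_ends g" "x \<notin> path_ends h" using eds True by auto
        then show ?thesis unfolding G0_def by auto
      qed
      have "\<exists>\<C>. finite \<C> \<and> disjoint \<C> \<and> (\<forall>C\<in>\<C>. simple_closed_curve C) \<and> \<Union>(path_image ` G0) = \<Union>\<C>"
      proof (rule less.hyps)
        show "card G0 < card G" using cardG0 by simp
        show "card {m \<in> G0. x \<in> path_ends m} = 2" if "k \<in> G0" "x \<in> path_ends k" for k x
          using two[of k x] that same[OF that] by (simp add: G0_def)
      qed (use finG0 arcs meet in \<open>auto simp: G0_def\<close>)
      then obtain \<C> where \<C>: "finite \<C>" "disjoint \<C>" "\<forall>C\<in>\<C>. simple_closed_curve C"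
        "\<Union>(path_image ` G0) = \<Union>\<C>" by blast
      have "path_image c \<inter> path_image k = {}" if "k \<in> G0" for k
      proof -
        have "path_image g \<inter> path_image k \<subseteq> {a, e} \<inter> path_ends k"
          "path_image h \<inter> path_image k \<subseteq> {e, b} \<inter> path_ends k"
          using meet[of g k] meet[of h k] that g hG eds unfolding G0_def by auto
        then show ?thesis using enot[OF that] anot[OF that] True img by blast
      qed
      then have "path_image c \<inter> \<Union>\<C> = {}" unfolding \<C>(4)[symmetric] by auto
      then have "disjoint (insert (path_image c) \<C>)"
        using \<C>(2) by (auto simp: disjoint_def)
      then show ?thesis
        using \<C> scc U by (intro exI[of _ "insert (path_image c) \<C>"]) auto
    next
      case False
      have arcc: "arc c"
        unfolding c_def
        by (rule arc_join) (use h' arcs[OF g] gh False ne in \<open>auto simp: e_def\<close>)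
      have edc: "path_ends c = {a, b}" using h' by (simp add: c_def a_def b_def path_ends_def)
      \<comment> \<open>Otherwise the image of \<open>g\<close>, contained in that of
        \<open>c\<close>, would reduce to end points of \<open>g\<close>, which its midpoint
        refutes. That \<open>c\<close> is new keeps the degree counts exact.\<close>
      have cG: "c \<notin> G"
      proof
        assume "c \<in> G"
        have "c \<noteq> g" using edc eds False ne by auto
        then have "path_image g \<subseteq> path_ends g" using meet[OF \<open>c \<in> G\<close> g] img by auto
        then show False using arc_midpoint_not_end[OF arcs[OF g]] by blast
      qed
      define G1 where "G1 = insert c G0"
      have edk: "path_image c \<inter> path_image k \<subseteq> path_ends c \<inter> path_ends k" if "k \<in> G0" for k
      proof -
        have "path_image g \<inter> path_image k \<subseteq> {a, e} \<inter> path_ends k"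
          "path_image h \<inter> path_image k \<subseteq> {e, b} \<inter> path_ends k"
          using meet[of g k] meet[of h k] that g hG eds unfolding G0_def by auto
        then show ?thesis using enot[OF that] img edc by blast
      qed
      have replace: "card {m \<in> G1. x \<in> path_ends m} = 2"
        if x: "x \<in> path_ends k" "k \<in> G1" for x k
      proof -
        have xe: "x \<noteq> e" using x enot edc ne unfolding G1_def by auto
        obtain k' where k': "k' \<in> G" "x \<in> path_ends k'"
          using x edc eds g hG unfolding G1_def G0_def by blast
        have c2: "card {m \<in> G. x \<in> path_ends m} = 2" using two k' by blast
        let ?S = "{m \<in> G. x \<in> path_ends m}"
        \<comment> \<open>At \<open>a\<close> the arc \<open>c\<close> replaces \<open>g\<close>, at
          \<open>b\<close> it replaces \<open>h\<close>; every other vertex keeps its arcs.\<close>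
        consider "x = a" | "x = b" | "x \<notin> {a, b}" by auto
        then show ?thesis
        proof cases
          case 1
          then have "{m \<in> G1. x \<in> path_ends m} = insert c (?S - {g})"
            using edc eds False ne unfolding G1_def G0_def by auto
          moreover have "g \<in> ?S" using 1 g eds by auto
          ultimately show ?thesis using c2 cG fin
            by (simp add: card_Diff_singleton)
        next
          case 2
          then have "{m \<in> G1. x \<in> path_ends m} = insert c (?S - {h})"
            using edc eds False ne unfolding G1_def G0_def by auto
          moreover have "h \<in> ?S" using 2 hG eds by auto
          ultimately show ?thesis using c2 cG fin
            by (simp add: card_Diff_singleton)
        next
          case 3
          then have "{m \<in> G1. x \<in> path_ends m} = ?S"
            using edc eds xe unfolding G1_def G0_def by auto
          then show ?thesis using c2 by simp
        qed
      qed
      have "\<exists>\<C>. finite \<C> \<and> disjoint \<C> \<and> (\<forall>C\<in>\<C>. simple_closed_curve C) \<and> \<Union>(path_image ` G1) = \<Union>\<C>"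
      proof (rule less.hyps)
        show "card G1 < card G" using cardG0 finG0 cG by (simp add: G1_def card_insert_if)
        show "finite G1" using finG0 by (simp add: G1_def)
        show "arc k" if "k \<in> G1" for k using that arcs arcc by (auto simp: G1_def G0_def)
        show "path_image k \<inter> path_image m \<subseteq> path_ends k \<inter> path_ends m"
          if km: "k \<in> G1" "m \<in> G1" "k \<noteq> m" for k m
        proof -
          consider "k = c" "m \<in> G0" | "m = c" "k \<in> G0" | "k \<in> G0" "m \<in> G0"
            using km unfolding G1_def by blast
          then show ?thesis
          proof cases
            case 1 then show ?thesis using edk[of m] by simp
          next
            case 2 then show ?thesis using edk[of k] by blast
          next
            case 3 then show ?thesis using meet[of k m] km unfolding G0_def by blast
          qed
        qed
      qed (use replace in blast)
      then show ?thesis using U unfolding G1_def by simp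
    qed
  qed
qed

section \<open>Cutting a compact, locally arc-like set into a graph of arcs\<close>

text \<open>The rest of the parameter interval has a compact, hence closed, image, and injectivity
  allows this image to be removed from the relatively open one.\<close>

lemma openin_arc_open_subinterval:
  fixes g :: "real \<Rightarrow> 'a::t2_space"
  assumes "arc g" and op: "openin (top_of_set N) (g ` {0<..<1})" and "0 \<le> a" "b \<le> 1"
  shows "openin (top_of_set N) (g ` {a<..<b})"
proof -
  have inj: "inj_on g {0..1}" and cont: "continuous_on {0..1} g"
    using assms by (auto simp: arc_def path_def)
  have "compact (g ` ({0..1} - {a<..<b}))"
    by (intro compact_continuous_image continuous_on_subset[OF cont] compact_diff) auto
  then have "closed (g ` ({0..1} - {a<..<b}))" by (rule compact_imp_closed)
  moreover have "g ` {a<..<b} = g ` {0<..<1} \<inter> - g ` ({0..1} - {a<..<b})"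
    using inj assms(3,4) by (fastforce simp: inj_on_def)
  ultimately show ?thesis using openin_Int_open[OF op] by (metis open_Compl)
qed

lemma closure_arc_open_subinterval:
  fixes g :: "real \<Rightarrow> 'a::real_normed_vector"
  assumes "arc g" "0 \<le> a" "a < b" "b \<le> 1"
  shows "closure (g ` {a<..<b}) = g ` {a..b}"
proof
  have cont: "continuous_on {0..1} g" using assms by (auto simp: arc_def path_def)
  have "compact (g ` {a..b})"
    using assms by (intro compact_continuous_image continuous_on_subset[OF cont]) auto
  then show "closure (g ` {a<..<b}) \<subseteq> g ` {a..b}"
    by (intro closure_minimal compact_imp_closed) (auto intro!: imageI)
  have "continuous_on (closure {a<..<b}) g"
    using assms by (intro continuous_on_subset[OF cont]) auto
  then have "g ` closure {a<..<b} \<subseteq> closure (g ` {a<..<b})"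
    by (rule image_closure_subset) (auto simp: closure_subset)
  then show "g ` {a..b} \<subseteq> closure (g ` {a<..<b})" using assms by simp
qed

text \<open>Serves two situations: if \<open>t\<close> is in \<open>T\<close>, then \<open>a\<close>
  and \<open>b\<close> are its neighbours on either side; otherwise they bound the gap containing
  \<open>t\<close>.\<close>

lemma adjacent_members:
  fixes T :: "'a::linorder set"
  assumes "finite T" "x \<in> T" "y \<in> T" "x < t" "t < y"
  obtains a b where "a \<in> T" "b \<in> T" "a < t" "t < b" "T \<inter> {a<..<b} \<subseteq> {t}"
proof -
  define a b where "a = Max {s \<in> T. s < t}" and "b = Min {s \<in> T. t < s}"
  have "a \<in> {s \<in> T. s < t}" unfolding a_def using assms by (intro Max_in) auto
  moreover have "b \<in> {s \<in> T. t < s}" unfolding b_def using assms by (intro Min_in) auto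
  moreover have "s \<le> a" if "s \<in> T" "s < t" for s
    unfolding a_def using assms that by (intro Max_ge) auto
  moreover have "b \<le> s" if "s \<in> T" "t < s" for s
    unfolding b_def using assms that by (intro Min_le) auto
  ultimately show thesis by (intro that[of a b]) force+
qed

text \<open>The compact set is cut at the end points of finitely many arcs covering it. The resulting
  pieces are open and closed in the complement of the cut points, so they are pairwise equal or
  disjoint, and every cut point, lying inside one of the arcs, ends exactly two of them.\<close>

theorem compact_locally_arc_imp_closed_curves:
  fixes N :: "(real^3) set"
  assumes "compact N"
    and loc: "\<And>p. p \<in> N \<Longrightarrow> \<exists>g. arc g \<and> path_image g \<subseteq> N \<and> p \<in> g ` {0<..<1} \<and>
      openin (top_of_set N) (g ` {0<..<1})"
  shows "\<exists>\<C>. finite \<C> \<and> disjoint \<C> \<and> (\<forall>C\<in>\<C>. simple_closed_curve C) \<and> N = \<Union>\<C>"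
proof -
  define good where "good g \<longleftrightarrow> arc g \<and> path_image g \<subseteq> N \<and> openin (top_of_set N) (g ` {0<..<1})"
    for g
  have "\<exists>h. \<forall>p\<in>N. good (h p) \<and> p \<in> h p ` {0<..<1}"
    using loc unfolding good_def by metis
  then obtain h where h: "\<And>p. p \<in> N \<Longrightarrow> good (h p) \<and> p \<in> h p ` {0<..<1}" by blast
  obtain D where D: "D \<subseteq> N" "finite D" "N \<subseteq> (\<Union>p\<in>D. h p ` {0<..<1})"
  proof -
    let ?C = "(\<lambda>p. h p ` {0<..<1}) ` N"
    have "\<forall>c\<in>?C. openin (top_of_set N) c" "N \<subseteq> \<Union>?C" using h by (auto simp: good_def)
    then obtain E where E: "E \<subseteq> ?C" "finite E" "N \<subseteq> \<Union>E"
      using \<open>compact N\<close> unfolding compact_eq_openin_cover by meson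
    obtain D where "D \<subseteq> N" "finite D" "E = (\<lambda>p. h p ` {0<..<1}) ` D"
      using finite_subset_image[OF E(2,1)] by blast
    then show thesis using that E(3) by simp
  qed
  define K where "K = h ` D"
  have K: "finite K" "\<And>g. g \<in> K \<Longrightarrow> good g" "\<And>p. p \<in> N \<Longrightarrow> \<exists>g\<in>K. p \<in> g ` {0<..<1}"
    using D h unfolding K_def by blast+
  have inj: "inj_on g {0..1}" and cont: "continuous_on {0..1} g" and arc: "arc g"
    if "g \<in> K" for g using K(2)[OF that] by (auto simp: good_def arc_def path_def)
  have inN: "g s \<in> N" if "g \<in> K" "s \<in> {0..1}" for g s
    using K(2)[OF that(1)] that(2) by (auto simp: good_def path_image_def)
  define F where "F = (\<Union>g\<in>K. {g 0, g 1})"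
  have F: "finite F" "F \<subseteq> N" using K(1) inN by (auto simp: F_def)
  \<comment> \<open>An arc is cut also where it runs through end points of other arcs of the cover;
    injectivity leaves finitely many such parameters.\<close>
  define T where "T g = {t\<in>{0..1::real}. g t \<in> F}" for g
  have T: "finite (T g)" "0 \<in> T g" "1 \<in> T g" if "g \<in> K" for g
  proof -
    have "T g = g -` F \<inter> {0..1}" by (auto simp: T_def)
    then show "finite (T g)" using finite_vimage_IntI[OF F(1) inj[OF that]] by simp
  qed (use that in \<open>auto simp: T_def F_def\<close>)
  define P where "P g = {(a, b). a \<in> T g \<and> b \<in> T g \<and> a < b \<and> T g \<inter> {a<..<b} = {}}" for g
  have Pin: "0 \<le> a" "a < b" "b \<le> 1" "a \<in> T g" "b \<in> T g" if "(a, b) \<in> P g" for a b g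
    using that by (auto simp: P_def T_def)
  \<comment> \<open>Pieces are kept as sets, not as parametrised arcs, because overlapping arcs of
    the cover produce the same piece several times.\<close>
  define pieces where "pieces = (\<Union>g\<in>K. (\<lambda>(a, b). g ` {a<..<b}) ` P g)"
  have "finite (P g)" if "g \<in> K" for g
    by (rule finite_subset[of _ "T g \<times> T g"]) (use T[OF that] in \<open>auto simp: P_def\<close>)
  then have finpieces: "finite pieces" using K(1) by (auto simp: pieces_def)
  have piece: "\<exists>g a b. g \<in> K \<and> (a, b) \<in> P g \<and> I = g ` {a<..<b}" if "I \<in> pieces" for I
    using that by (auto simp: pieces_def)
  have pieceF: "I \<inter> F = {}" "closure I - I \<subseteq> F" "connected I" "I \<noteq> {}"
    "openin (top_of_set N) I" "closure I \<subseteq> N" if I: "I \<in> pieces" for I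
  proof -
    obtain g a b where g: "g \<in> K" "(a, b) \<in> P g" "I = g ` {a<..<b}" using piece[OF I] by blast
    note ab = Pin[OF g(2)]
    have "t \<notin> T g" if "t \<in> {a<..<b}" for t using that g(2) by (auto simp: P_def)
    then have "g t \<notin> F" if "t \<in> {a<..<b}" for t using that ab(1,3) by (auto simp: T_def)
    then show "I \<inter> F = {}" unfolding g(3) by blast
    have cl: "closure I = g ` {a..b}"
      unfolding g(3) using closure_arc_open_subinterval arc g(1) ab by blast
    have "g a \<in> F" "g b \<in> F" using ab by (auto simp: T_def)
    moreover have "{a..b} = insert a (insert b {a<..<b})" using ab by auto
    ultimately show "closure I - I \<subseteq> F" unfolding cl unfolding g(3) by auto
    show "connected I" unfolding g(3) using ab
      by (intro connected_continuous_image continuous_on_subset[OF cont[OF g(1)]]) auto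
    show "I \<noteq> {}" unfolding g(3) using ab dense[of a b] by auto
    show "openin (top_of_set N) I"
      unfolding g(3) using K(2)[OF g(1)] ab openin_arc_open_subinterval by (auto simp: good_def)
    show "closure I \<subseteq> N" unfolding cl using inN[OF g(1)] ab by auto
  qed
  have INsub: "I \<subseteq> J" if "I \<in> pieces" "J \<in> pieces" "I \<inter> J \<noteq> {}" for I J
  proof -
    have IN: "I \<subseteq> N - F" using pieceF(1,6)[OF that(1)] closure_subset[of I] by blast
    have "I \<inter> J = I \<inter> closure J"
      using IN pieceF(2)[OF that(2)] closure_subset[of J] by blast
    then have "closedin (top_of_set I) (I \<inter> J)" by (simp add: closedin_closed_Int)
    moreover have "openin (top_of_set I) (I \<inter> J)"
    proof (rule openin_subtopology_Int_subset[of N])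
      have "N \<inter> J = J" using pieceF(6)[OF that(2)] closure_subset[of J] by blast
      then show "openin (top_of_set N) (N \<inter> J)" using pieceF(5)[OF that(2)] by simp
    qed (use IN in blast)
    ultimately have "I \<inter> J = I"
      using pieceF(3)[OF that(1)] that(3) unfolding connected_clopen by blast
    then show ?thesis by blast
  qed
  then have disj: "I = J \<or> I \<inter> J = {}" if "I \<in> pieces" "J \<in> pieces" for I J
    using that by blast
  have "\<exists>k. arc k \<and> path_image k = closure I \<and> path_ends k = closure I - I"
    if I: "I \<in> pieces" for I
  proof -
    obtain g a b where g: "g \<in> K" "(a, b) \<in> P g" "I = g ` {a<..<b}" using piece[OF I] by blast
    note ab = Pin[OF g(2)]
    have cl: "closure I = g ` {a..b}"
      unfolding g(3) using closure_arc_open_subinterval arc g(1) ab by blast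
    have "g ` {a..b} - g ` {a<..<b} = g ` ({a..b} - {a<..<b})"
      by (rule inj_on_image_set_diff[symmetric, OF inj[OF g(1)]]) (use ab in auto)
    also have "{a..b} - {a<..<b} = {a, b}" using ab by auto
    finally have "closure I - I = {g a, g b}" unfolding cl unfolding g(3) by simp
    then show ?thesis
      using ab cl arc_subpath_arc[OF arc[OF g(1)], of a b]
      by (intro exI[of _ "subpath a b g"])
         (auto simp: path_image_subpath path_ends_def)
  qed
  then obtain k where k: "\<And>I. I \<in> pieces \<Longrightarrow> arc (k I)"
    "\<And>I. I \<in> pieces \<Longrightarrow> path_image (k I) = closure I"
    "\<And>I. I \<in> pieces \<Longrightarrow> path_ends (k I) = closure I - I" by metis
  \<comment> \<open>A piece is recovered from its arc by removing the end points from the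
    image.\<close>
  have injk: "inj_on k pieces"
  proof (rule inj_onI)
    fix I J assume IJ: "I \<in> pieces" "J \<in> pieces" "k I = k J"
    then have "closure I = closure J" "closure I - I = closure J - J" using k by metis+
    then show "I = J" using closure_subset[of I] closure_subset[of J] by blast
  qed
  have two: "card {I \<in> pieces. e \<in> closure I - I} = 2" if eF: "e \<in> F" for e
  proof -
    obtain g t where g: "g \<in> K" "t \<in> {0<..<1}" "e = g t" using K(3) F(2) eF by blast
    obtain a b where ab: "a \<in> T g" "b \<in> T g" "a < t" "t < b" "T g \<inter> {a<..<b} \<subseteq> {t}"
      using adjacent_members[OF T(1)[OF g(1)] T(2)[OF g(1)] T(3)[OF g(1)]] g(2) by auto
    have t: "t \<in> T g" using eF g by (auto simp: T_def)
    have ab01: "0 \<le> a" "b \<le> 1" using ab by (auto simp: T_def)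
    define L R where "L = g ` {a<..<t}" and "R = g ` {t<..<b}"
    have "(a, t) \<in> P g" "(t, b) \<in> P g" using ab t by (auto simp: P_def)
    then have LR: "L \<in> pieces" "R \<in> pieces" using g(1) by (auto simp: pieces_def L_def R_def)
    have "L \<inter> R = g ` ({a<..<t} \<inter> {t<..<b})" unfolding L_def R_def
      by (rule inj_on_image_Int[symmetric, OF inj[OF g(1)]]) (use g(2) ab ab01 in auto)
    then have "L \<inter> R = {}" by auto
    then have "L \<noteq> R" using pieceF(4)[OF LR(1)] by auto
    \<comment> \<open>This neighbourhood of \<open>e\<close> in \<open>N\<close> excludes a third
      piece: a piece that has \<open>e\<close> in its closure, but not as an element, meets
      \<open>L\<close> or \<open>R\<close> and therefore equals it.\<close>
    have nhd: "insert e (L \<union> R) = g ` {a<..<b}"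
    proof -
      have "{a<..<b} = insert t ({a<..<t} \<union> {t<..<b})" using ab by auto
      then show ?thesis by (simp add: L_def R_def g(3) image_Un)
    qed
    have op: "openin (top_of_set N) (insert e (L \<union> R))"
      unfolding nhd using K(2)[OF g(1)] ab01 openin_arc_open_subinterval by (auto simp: good_def)
    have "{I \<in> pieces. e \<in> closure I - I} = {L, R}"
    proof (intro equalityI subsetI)
      fix J assume "J \<in> {I \<in> pieces. e \<in> closure I - I}"
      then have J: "J \<in> pieces" "e \<in> closure J" "e \<notin> J" by auto
      obtain U where U: "open U" "insert e (L \<union> R) = N \<inter> U" using op by (auto simp: openin_open)
      have "e \<in> U \<inter> closure J" using U(2) J(2) by blast
      then obtain x where x: "x \<in> U" "x \<in> J" using open_Int_closure_eq_empty[OF U(1)] by blast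
      then have "x \<in> N" using pieceF(6)[OF J(1)] closure_subset[of J] by blast
      then have "x \<in> insert e (L \<union> R)" using U(2) x(1) by blast
      then have "x \<in> L \<or> x \<in> R" using J(3) x(2) by blast
      then show "J \<in> {L, R}" using disj[OF J(1) LR(1)] disj[OF J(1) LR(2)] x(2) by blast
    next
      fix J assume J: "J \<in> {L, R}"
      have "closure L = g ` {a..t}" "closure R = g ` {t..b}"
        unfolding L_def R_def using closure_arc_open_subinterval[OF arc[OF g(1)]] ab ab01 g(2) by auto
      then have "e \<in> closure L" "e \<in> closure R" using g(3) ab by auto
      then show "J \<in> {I \<in> pieces. e \<in> closure I - I}" using J LR pieceF(1) eF by blast
    qed
    then show ?thesis using \<open>L \<noteq> R\<close> by simp
  qed
  have union: "\<Union>(path_image ` k ` pieces) = N"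
  proof -
    have "\<Union>(closure ` pieces) = N"
    proof (intro equalityI subsetI)
      fix x assume "x \<in> N"
      show "x \<in> \<Union>(closure ` pieces)"
      proof (cases "x \<in> F")
        case True
        then have "{I \<in> pieces. x \<in> closure I - I} \<noteq> {}" using two[OF True] by (metis card.empty zero_neq_numeral)
        then obtain I where "I \<in> pieces" "x \<in> closure I" by auto
        then show ?thesis by (rule UN_I)
      next
        case False
        obtain g t where g: "g \<in> K" "t \<in> {0<..<1}" "x = g t" using K(3) \<open>x \<in> N\<close> by blast
        obtain a b where ab: "a \<in> T g" "b \<in> T g" "a < t" "t < b" "T g \<inter> {a<..<b} \<subseteq> {t}"
          using adjacent_members[OF T(1)[OF g(1)] T(2)[OF g(1)] T(3)[OF g(1)]] g(2) by auto
        moreover have "t \<notin> T g" using False g by (auto simp: T_def)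
        ultimately have "(a, b) \<in> P g" by (auto simp: P_def)
        then have "g ` {a<..<b} \<in> pieces" "x \<in> g ` {a<..<b}"
          using g ab by (auto simp: pieces_def)
        then show ?thesis using closure_subset[of "g ` {a<..<b}"] by (intro UN_I) auto
      qed
    qed (use pieceF(6) in auto)
    then show ?thesis using k(2) by simp
  qed
  have "\<exists>\<C>. finite \<C> \<and> disjoint \<C> \<and> (\<forall>C\<in>\<C>. simple_closed_curve C) \<and>
    \<Union>(path_image ` k ` pieces) = \<Union>\<C>"
  proof (rule two_regular_arc_graph_closed_curves)
    show "finite (k ` pieces)" using finpieces by simp
    show "arc g" if "g \<in> k ` pieces" for g using that k by auto
    show "path_image g \<inter> path_image h \<subseteq> path_ends g \<inter> path_ends h"
      if gh: "g \<in> k ` pieces" "h \<in> k ` pieces" "g \<noteq> h" for g h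
    proof -
      obtain I J where IJ: "I \<in> pieces" "J \<in> pieces" "g = k I" "h = k J" "I \<noteq> J"
        using gh by blast
      then show ?thesis
        using pieceF(1,2)[OF IJ(1)] pieceF(1,2)[OF IJ(2)] disj[OF IJ(1,2)]
        unfolding IJ(3,4) k(2,3)[OF IJ(1)] k(2,3)[OF IJ(2)] by blast
    qed
    show "card {h \<in> k ` pieces. e \<in> path_ends h} = 2"
      if g: "g \<in> k ` pieces" "e \<in> path_ends g" for g e
    proof -
      have "e \<in> F" using g k(3) pieceF(2) by blast
      have "{h \<in> k ` pieces. e \<in> path_ends h} = k ` {I \<in> pieces. e \<in> closure I - I}"
        using k(3) by auto
      also have "card \<dots> = card {I \<in> pieces. e \<in> closure I - I}"
        by (intro card_image inj_on_subset[OF injk]) auto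
      finally show ?thesis using two[OF \<open>e \<in> F\<close>] by simp
    qed
  qed
  then show ?thesis using union by simp
qed

section \<open>Regular zero sets on the sphere\<close>

text \<open>Expanding the double cross product shows that \<open>h\<close> is parallel to
  \<open>cross3 p q\<close>; being orthogonal to it as well, it vanishes. This gives injectivity of
  the derivative in the inverse function theorem.\<close>

lemma orthogonal_triple_imp_zero:
  fixes p q h :: "real^3"
  assumes "cross3 p q \<noteq> 0" "p \<bullet> h = 0" "q \<bullet> h = 0" "cross3 p q \<bullet> h = 0"
  shows "h = 0"
proof -
  have "cross3 h (cross3 p q) = (h \<bullet> q) *\<^sub>R p - (h \<bullet> p) *\<^sub>R q"
    by (simp add: Lagrange)
  then have "cross3 h (cross3 p q) = 0" using assms by (simp add: inner_commute)
  moreover have "h \<bullet> cross3 p q = 0" using assms by (simp add: inner_commute)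
  ultimately show ?thesis using norm_and_cross_eq_0[of h "cross3 p q"] assms(1) by blast
qed

text \<open>The inverse function theorem is applied to the map whose components are the squared norm,
  the given function and the linear form of the direction \<open>p \<times> a p\<close> tangent to the zero set.\<close>

lemma regular_zero_locally_arc:
  fixes F :: "real^3 \<Rightarrow> real" and a :: "real^3 \<Rightarrow> real^3"
  assumes der: "\<And>x. (F has_derivative (\<lambda>h. a x \<bullet> h)) (at x)" and conta: "continuous_on UNIV a"
    and p: "p \<in> nodal_set F" and reg: "cross3 p (a p) \<noteq> 0"
  shows "\<exists>g. arc g \<and> path_image g \<subseteq> nodal_set F \<and> p \<in> g ` {0<..<1} \<and>
    openin (top_of_set (nodal_set F)) (g ` {0<..<1})"
proof -
  define v where "v = cross3 p (a p)"
  define e1 e2 e3 :: "real^3" where "e1 = axis 1 1" and "e2 = axis 2 1" and "e3 = axis 3 1"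
  have comp: "(x *\<^sub>R e1 + y *\<^sub>R e2 + z *\<^sub>R e3) $ 1 = x"
      "(x *\<^sub>R e1 + y *\<^sub>R e2 + z *\<^sub>R e3) $ 2 = y"
      "(x *\<^sub>R e1 + y *\<^sub>R e2 + z *\<^sub>R e3) $ 3 = z" for x y z
    by (simp_all add: e1_def e2_def e3_def axis_def)
  define \<Phi> where "\<Phi> x = (x \<bullet> x) *\<^sub>R e1 + F x *\<^sub>R e2 + (v \<bullet> x) *\<^sub>R e3" for x
  define d where "d x h = (2 * (x \<bullet> h)) *\<^sub>R e1 + (a x \<bullet> h) *\<^sub>R e2 + (v \<bullet> h) *\<^sub>R e3" for x h
  have bl: "bounded_linear (d x)" for x
    unfolding d_def by (intro bounded_linear_intros)
  have ap: "blinfun_apply (Blinfun (d x)) = d x" for x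
    by (rule bounded_linear_Blinfun_apply[OF bl])
  have der\<Phi>: "(\<Phi> has_derivative d x) (at x)" for x
    unfolding \<Phi>_def d_def
    by (rule derivative_eq_intros der refl)+ (simp add: inner_commute algebra_simps)
  have cont\<Phi>: "continuous_on S \<Phi>" for S
    using der\<Phi> has_derivative_continuous_on has_derivative_at_withinI by metis
  have contd: "continuous_on UNIV (\<lambda>x. Blinfun (d x))"
    by (rule continuous_on_blinfun_componentwise)
       (unfold ap, unfold d_def, intro continuous_intros conta)
  have "inj (d p)"
  proof (subst linear_injective_0)
    show "linear (d p)" using bl by (rule bounded_linear.linear)
    show "\<forall>h. d p h = 0 \<longrightarrow> h = 0"
    proof (intro allI impI)
      fix h assume "d p h = 0"
      then have "d p h $ 1 = 0" "d p h $ 2 = 0" "d p h $ 3 = 0" by simp_all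
      then show "h = 0"
        unfolding d_def comp v_def using orthogonal_triple_imp_zero[OF reg] by simp
    qed
  qed
  then obtain L where L: "linear L" "L \<circ> d p = id"
    using linear_injective_left_inverse bl bounded_linear.linear by blast
  have "Blinfun L o\<^sub>L Blinfun (d p) = id_blinfun"
    using L by (intro blinfun_eqI)
      (simp add: ap bounded_linear_Blinfun_apply linear_conv_bounded_linear[symmetric] fun_eq_iff)
  then obtain U V g g' where U: "open U" "p \<in> U" "open V" "\<Phi> p \<in> V" "homeomorphism U V \<Phi> g"
    using inverse_function_theorem[of UNIV \<Phi> "\<lambda>x. Blinfun (d x)" p "Blinfun L"] der\<Phi> contd ap
    by (metis UNIV_I open_UNIV)
  have pS: "p \<bullet> p = 1" "F p = 0" using p by (auto simp: nodal_set_def dot_square_norm)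
  have c: "\<Phi> p = e1" by (simp add: \<Phi>_def pS v_def dot_cross_self)
  obtain \<epsilon> where \<epsilon>: "\<epsilon> > 0" "cball e1 \<epsilon> \<subseteq> V"
    using U(3,4) c open_contains_cball by metis
  have e3: "norm e3 = 1" by (simp add: e3_def)
  \<comment> \<open>In the coordinates \<open>\<Phi>\<close> the zero set near \<open>p\<close> is
    the line through \<open>e1\<close> in the direction \<open>e3\<close>. This segment of it has
    half-length \<open>\<epsilon>\<close>, and \<open>s = 1/2\<close> corresponds to
    \<open>p\<close>.\<close>
  define l where "l s = e1 + ((2 * s - 1) * \<epsilon>) *\<^sub>R e3" for s :: real
  have le: "dist e1 (l s) = \<bar>2 * s - 1\<bar> * \<epsilon>" for s
    using \<epsilon> by (simp add: l_def dist_norm e3 abs_mult)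
  have lV: "l s \<in> V" if "s \<in> {0..1}" for s
  proof -
    have "\<bar>2 * s - 1\<bar> \<le> 1" using that by auto
    then have "\<bar>2 * s - 1\<bar> * \<epsilon> \<le> 1 * \<epsilon>" using \<epsilon> by (intro mult_right_mono) auto
    then show ?thesis using \<epsilon>(2) le[of s] by auto
  qed
  have \<Phi>g: "\<Phi> (g y) = y" "g y \<in> U" if "y \<in> V" for y
    using U(5) that by (auto simp: homeomorphism_def)
  have g\<Phi>: "g (\<Phi> x) = x" if "x \<in> U" for x
    using U(5) that by (auto simp: homeomorphism_def)
  have nodal: "x \<in> nodal_set F \<longleftrightarrow> x \<bullet> x = 1 \<and> F x = 0" for x
    by (simp add: nodal_set_def norm_eq_1)
  define \<gamma> where "\<gamma> = g \<circ> l"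
  have lcomp: "l s = 1 *\<^sub>R e1 + 0 *\<^sub>R e2 + ((2 * s - 1) * \<epsilon>) *\<^sub>R e3" for s by (simp add: l_def)
  have "arc \<gamma>"
    unfolding arc_def path_def
  proof
    have "continuous_on {0..1} l" unfolding l_def by (intro continuous_intros)
    moreover have "continuous_on (l ` {0..1}) g"
      by (rule continuous_on_subset[of V]) (use U(5) lV in \<open>auto simp: homeomorphism_def\<close>)
    ultimately show "continuous_on {0..1} \<gamma>"
      unfolding \<gamma>_def by (rule continuous_on_compose)
    show "inj_on \<gamma> {0..1}"
    proof (rule inj_onI)
      fix s t :: real assume st: "s \<in> {0..1}" "t \<in> {0..1}" "\<gamma> s = \<gamma> t"
      then have "l s = l t" using \<Phi>g(1)[OF lV[OF st(1)]] \<Phi>g(1)[OF lV[OF st(2)]]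
        by (metis \<gamma>_def comp_apply)
      then have "l s $ 3 = l t $ 3" by simp
      then have "(2 * s - 1) * \<epsilon> = (2 * t - 1) * \<epsilon>" unfolding lcomp comp .
      then show "s = t" using \<epsilon> by simp
    qed
  qed
  moreover have im: "\<gamma> s \<in> nodal_set F" if "s \<in> {0..1}" for s
  proof -
    have "\<Phi> (\<gamma> s) = l s" using \<Phi>g lV that by (simp add: \<gamma>_def)
    then have "\<Phi> (\<gamma> s) $ 1 = l s $ 1" "\<Phi> (\<gamma> s) $ 2 = l s $ 2" by simp_all
    then show ?thesis unfolding \<Phi>_def lcomp comp nodal by simp
  qed
  moreover have "p \<in> \<gamma> ` {0<..<1}"
  proof
    have "g e1 = p" using g\<Phi>[OF U(2)] c by simp
    then show "p = \<gamma> (1/2)" by (simp add: \<gamma>_def l_def)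
  qed simp
  moreover have "openin (top_of_set (nodal_set F)) (\<gamma> ` {0<..<1})"
  proof -
    \<comment> \<open>The open ball cuts off exactly the two ends of the segment, which lie at
      distance \<open>\<epsilon>\<close> from its centre.\<close>
    have "open (U \<inter> \<Phi> -` ball e1 \<epsilon>)"
      using U(1) by (intro open_Int open_vimage cont\<Phi>) auto
    moreover have "\<gamma> ` {0<..<1} = nodal_set F \<inter> (U \<inter> \<Phi> -` ball e1 \<epsilon>)"
    proof (intro equalityI subsetI)
      fix x assume "x \<in> \<gamma> ` {0<..<1}"
      then obtain s where s: "s \<in> {0<..<1}" "x = \<gamma> s" by auto
      have "\<bar>2 * s - 1\<bar> < 1" using s by auto
      then have "\<bar>2 * s - 1\<bar> * \<epsilon> < 1 * \<epsilon>" using \<epsilon> by (intro mult_strict_right_mono) auto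
      then have "l s \<in> ball e1 \<epsilon>" using le[of s] by simp
      then show "x \<in> nodal_set F \<inter> (U \<inter> \<Phi> -` ball e1 \<epsilon>)"
        using im[of s] \<Phi>g lV[of s] s by (simp add: \<gamma>_def)
    next
      fix x assume x: "x \<in> nodal_set F \<inter> (U \<inter> \<Phi> -` ball e1 \<epsilon>)"
      define s where "s = ((v \<bullet> x) / \<epsilon> + 1) / 2"
      have "(2 * s - 1) * \<epsilon> = v \<bullet> x" using \<epsilon> by (simp add: s_def field_simps)
      then have \<Phi>x: "\<Phi> x = l s" using x nodal[of x] by (simp add: \<Phi>_def lcomp)
      then have "\<bar>2 * s - 1\<bar> * \<epsilon> < 1 * \<epsilon>" using x le[of s] by simp
      then have "\<bar>2 * s - 1\<bar> < 1" using \<epsilon> by (simp only: mult_less_cancel_right_pos)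
      then have "s \<in> {0<..<1}" by auto
      moreover have "x = \<gamma> s" using g\<Phi>[of x] \<Phi>x x by (simp add: \<gamma>_def)
      ultimately show "x \<in> \<gamma> ` {0<..<1}" by blast
    qed
    ultimately show ?thesis by (simp add: openin_open_Int)
  qed
  ultimately show ?thesis by (intro exI[of _ \<gamma>]) (auto simp: path_image_def)
qed

section \<open>Legendre polynomials\<close>

text \<open>Rolle's theorem between consecutive points, organised by removing the maximum: the new
  zero lies beyond all earlier ones and so differs from them. Differentiability is asked only
  between the extreme points, since one application is to a function with a pole at
  \<open>0\<close>.\<close>

lemma Rolle_finite_set:
  fixes f f' :: "real \<Rightarrow> real"
  assumes "finite S" "card S = Suc m" "\<And>x. x \<in> S \<Longrightarrow> f x = 0"
    and "\<And>x. Min S \<le> x \<Longrightarrow> x \<le> Max S \<Longrightarrow> (f has_real_derivative f' x) (at x)"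
  shows "\<exists>T. finite T \<and> card T = m \<and> T \<subseteq> {Min S<..<Max S} \<and> (\<forall>x\<in>T. f' x = 0)"
  using assms
proof (induction m arbitrary: S)
  case 0
  then show ?case by (intro exI[of _ "{}"]) simp
next
  case (Suc m)
  define M S0 where "M = Max S" and "S0 = S - {M}"
  have "S \<noteq> {}" using Suc.prems(2) by auto
  then have M: "M \<in> S" using Suc.prems(1) by (simp add: M_def)
  have S0: "finite S0" "card S0 = Suc m" using M Suc.prems(1,2) by (simp_all add: S0_def)
  then have ne: "S0 \<noteq> {}" by auto
  have le: "Min S \<le> Min S0" using S0(1) ne Suc.prems(1) by (intro Min_antimono) (auto simp: S0_def)
  have M0: "Max S0 \<in> S0" using S0(1) ne by simp
  then have "Max S0 \<noteq> M" "Max S0 \<in> S" by (auto simp: S0_def)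
  then have lt: "Max S0 < M" using Suc.prems(1) by (simp add: M_def order.not_eq_order_implies_strict)
  obtain T where T: "finite T" "card T = m" "T \<subseteq> {Min S0<..<Max S0}" "\<forall>x\<in>T. f' x = 0"
    using Suc.IH[OF S0] Suc.prems(3,4) le lt by (force simp: S0_def M_def)
  have der: "(f has_real_derivative f' x) (at x)" if "Max S0 \<le> x" "x \<le> M" for x
    using that Suc.prems(4)[of x] le Min_le[OF S0(1) M0] by (simp add: M_def)
  have "\<exists>z. Max S0 < z \<and> z < M \<and> DERIV f z :> 0"
  proof (rule Rolle[OF lt])
    show "f (Max S0) = f M" using Suc.prems(3) M \<open>Max S0 \<in> S\<close> by simp
    show "continuous_on {Max S0..M} f"
      using der by (intro DERIV_atLeastAtMost_imp_continuous_on) auto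
    show "f differentiable at x" if "Max S0 < x" "x < M" for x
      unfolding real_differentiable_def using der[of x] that by (meson less_imp_le)
  qed
  then obtain z where z: "Max S0 < z" "z < M" "DERIV f z :> 0" by blast
  then have "f' z = 0" using der[of z] DERIV_unique by force
  moreover have "z \<notin> T" using T(3) z by force
  moreover have "Min S \<le> Max S0" using le Min_le[OF S0(1) M0] by simp
  ultimately show ?case
    using T z le lt by (intro exI[of _ "insert z T"]) (force simp: M_def)
qed

lemma power_dvd_pderiv:
  fixes p q :: "real poly"
  assumes "q ^ Suc j dvd p"
  shows "q ^ j dvd pderiv p"
proof -
  obtain s where "p = q ^ Suc j * s" using assms by (rule dvdE)
  then have "pderiv p = q ^ Suc j * pderiv s + s * (smult (of_nat (Suc j)) (q ^ j) * pderiv q)"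
    by (simp only: pderiv_mult pderiv_power_Suc)
  moreover have "q ^ j dvd q ^ Suc j * pderiv s" by simp
  moreover have "q ^ j dvd s * (smult (of_nat (Suc j)) (q ^ j) * pderiv q)"
    by (intro dvd_mult dvd_mult2 dvd_smult) simp
  ultimately show ?thesis by (simp only: dvd_add)
qed

lemma pow_dvd_higher_pderiv:
  fixes q :: "real poly"
  shows "k \<le> n \<Longrightarrow> q ^ (n - k) dvd (pderiv ^^ k) (q ^ n)"
proof (induction k)
  case (Suc k)
  then have "q ^ Suc (n - Suc k) dvd (pderiv ^^ k) (q ^ n)" by (simp add: Suc_diff_Suc)
  then show ?case by (simp add: power_dvd_pderiv)
qed simp

text \<open>As long as \<open>k < n\<close>, the \<open>k\<close>-th derivative keeps a factor
  \<open>t^2 - 1\<close>. Its \<open>k\<close> inner zeros together with \<open>-1\<close> and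
  \<open>1\<close> are \<open>k + 2\<close> points, and Rolle's theorem gives \<open>k + 1\<close>
  inner zeros of the next derivative.\<close>

lemma higher_pderiv_roots:
  "k \<le> n \<Longrightarrow> \<exists>T. finite T \<and> card T = k \<and> T \<subseteq> {-1<..<1} \<and>
    (\<forall>x\<in>T. poly ((pderiv ^^ k) ([:-1, 0, 1:] ^ n)) x = (0::real))"
proof (induction k)
  case (Suc k)
  let ?q = "[:-1, 0, 1:] :: real poly"
  let ?p = "(pderiv ^^ k) (?q ^ n)"
  obtain T where T: "finite T" "card T = k" "T \<subseteq> {-1<..<1}" "\<forall>x\<in>T. poly ?p x = 0"
    using Suc by auto
  have "?q dvd ?q ^ (n - k)" using Suc.prems by (simp add: dvd_power)
  then have "?q dvd ?p" using pow_dvd_higher_pderiv[of k n ?q] Suc.prems dvd_trans by fastforce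
  then have ends: "poly ?p 1 = 0" "poly ?p (-1) = 0" by (auto elim!: dvdE)
  define S where "S = insert (-1) (insert 1 T)"
  have S: "finite S" using T(1) by (simp add: S_def)
  have "card S = Suc (Suc k)" using T(1-3) by (subst S_def) (auto simp: card_insert_if)
  moreover have "Min S = -1" using S T(3) by (intro Min_eqI) (auto simp: S_def)
  moreover have "Max S = 1" using S T(3) by (intro Max_eqI) (auto simp: S_def)
  moreover have "poly ?p x = 0" if "x \<in> S" for x using that T(4) ends by (auto simp: S_def)
  ultimately show ?case
    using Rolle_finite_set[of S "Suc k" "poly ?p" "poly (pderiv ?p)"] S by simp
qed auto

lemma degree_higher_pderiv_real: "degree ((pderiv ^^ k) p) = degree p - k" for p :: "real poly"
  by (induction k) (simp_all add: degree_pderiv)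

lemma degree_legendre_poly: "degree (legendre_poly n) = n"
  by (simp add: legendre_poly_def degree_higher_pderiv_real degree_power_eq)

lemma legendre_poly_nonzero: "legendre_poly n \<noteq> 0"
proof (cases n)
  case (Suc m)
  then show ?thesis using degree_legendre_poly[of n] by auto
qed (simp add: legendre_poly_def)

lemma legendre_poly_roots:
  "\<exists>T. finite T \<and> card T = n \<and> T \<subseteq> {-1<..<1} \<and> T = {x. poly (legendre_poly n) x = 0}"
proof -
  obtain T where T: "finite T" "card T = n" "T \<subseteq> {-1<..<1}"
    "\<forall>x\<in>T. poly ((pderiv ^^ n) ([:-1, 0, 1:] ^ n)) x = (0::real)"
    using higher_pderiv_roots[of n n] by auto
  have "T = {x. poly (legendre_poly n) x = 0}"
  proof (rule card_seteq)
    show "finite {x. poly (legendre_poly n) x = 0}"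
      by (rule poly_roots_finite[OF legendre_poly_nonzero])
    show "T \<subseteq> {x. poly (legendre_poly n) x = 0}" using T(4) by (auto simp: legendre_poly_def)
    show "card {x. poly (legendre_poly n) x = 0} \<le> card T"
      using card_poly_roots_bound[OF legendre_poly_nonzero, of n] T(2)
      by (simp add: degree_legendre_poly)
  qed
  then show ?thesis using T by blast
qed

section \<open>Parity, the differential equation and simplicity of the zeros\<close>

lemma legendre_poly_minus:
  "poly (legendre_poly n) (- x) = (-1) ^ n * poly (legendre_poly n) x"
proof -
  let ?m = "[:0, -1:] :: real poly"
  have "pcompose ((pderiv ^^ k) p) ?m = smult ((-1) ^ k) ((pderiv ^^ k) (pcompose p ?m))"
    for k and p :: "real poly"
  proof (induction k)
    case (Suc k)
    have "pderiv (pcompose ((pderiv ^^ k) p) ?m) = - pcompose ((pderiv ^^ Suc k) p) ?m"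
      by (simp add: pderiv_pcompose pderiv_pCons)
    then show ?case using Suc by (simp add: pderiv_smult)
  qed simp
  moreover have "pcompose ([:-1, 0, 1:] ^ n) ?m = ([:-1, 0, 1:] :: real poly) ^ n"
    by (intro poly_ext) (simp add: poly_pcompose)
  ultimately have "pcompose (legendre_poly n) ?m = smult ((-1) ^ n) (legendre_poly n)"
    by (simp add: legendre_poly_def pcompose_smult)
  then have "poly (pcompose (legendre_poly n) ?m) x = poly (smult ((-1) ^ n) (legendre_poly n)) x"
    by simp
  then show ?thesis by (simp add: poly_pcompose)
qed

text \<open>The power \<open>u = (t^2 - 1)^n\<close> satisfies
  \<open>(t^2 - 1) u' = 2 n t u\<close>, which is \<open>base\<close>. Differentiating this
  \<open>k + 1\<close> times, by an induction that stands for Leibniz's rule, and taking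
  \<open>k = n\<close> gives Legendre's equation.\<close>

lemma legendre_ode:
  "(1 - t\<^sup>2) * poly (pderiv (pderiv (legendre_poly n))) t =
    2 * t * poly (pderiv (legendre_poly n)) t - real n * (real n + 1) * poly (legendre_poly n) t"
proof -
  define q :: "real poly" where "q = [:-1, 0, 1:]"
  define D where "D k = (pderiv ^^ k) (q ^ n)" for k
  have D: "pderiv (D k) = D (Suc k)" for k by (simp add: D_def)
  have q: "pderiv q = [:0, 2:]" by (simp add: q_def pderiv_pCons)
  have base: "q * D 1 = smult (2 * real n) ([:0, 1:] * D 0)"
  proof (cases n)
    case (Suc m)
    have "pderiv (q ^ Suc m) = smult (real (Suc m)) (q ^ m) * [:0, 2:]"
      by (simp only: pderiv_power_Suc q)
    then show ?thesis using Suc by (simp add: D_def algebra_simps)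
  qed (simp add: D_def)
  have "q * D (Suc (Suc k)) + smult (2 * (real k + 1)) ([:0, 1:] * D (Suc k))
      + smult ((real k + 1) * real k) (D k)
      = smult (2 * real n) ([:0, 1:] * D (Suc k)) + smult (2 * real n * (real k + 1)) (D k)" for k
  proof (induction k)
    case 0
    have "poly (pderiv (q * D 1)) t = poly (pderiv (smult (2 * real n) ([:0, 1:] * D 0))) t" for t
      by (simp only: base)
    then show ?case
      by (intro poly_ext) (simp add: pderiv_mult pderiv_smult pderiv_add D q pderiv_pCons algebra_simps)
  next
    case (Suc k)
    from arg_cong[OF Suc.IH, of "\<lambda>p. poly (pderiv p)"]
    show ?case
      by (intro poly_ext) (simp add: pderiv_mult pderiv_smult pderiv_add D q pderiv_pCons algebra_simps fun_eq_iff)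
  qed
  from arg_cong[OF this, of "\<lambda>p. poly p t" n]
  have ode: "(1 - t\<^sup>2) * poly (D (Suc (Suc n))) t = 2 * t * poly (D (Suc n)) t - real n * (real n + 1) * poly (D n) t"
    by (simp add: q_def algebra_simps power2_eq_square)
  define c where "c = 1 / (2 ^ n * fact n :: real)"
  have "legendre_poly n = smult c (D n)" by (simp add: legendre_poly_def c_def D_def q_def)
  then show ?thesis
    using arg_cong[OF ode, of "(*) c"] by (simp add: pderiv_smult D algebra_simps)
qed

text \<open>Dividing by the linear factor of a double zero would leave a polynomial of degree
  \<open>n - 1\<close> that still has all \<open>n\<close> distinct zeros.\<close>

lemma legendre_poly_simple_root:
  assumes "poly (legendre_poly n) t = 0"
  shows "poly (pderiv (legendre_poly n)) t \<noteq> 0"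
proof
  let ?P = "legendre_poly n"
  assume d: "poly (pderiv ?P) t = 0"
  obtain Q where Q: "?P = [:-t, 1:] * Q" using assms poly_eq_0_iff_dvd by (metis dvdE)
  have "pderiv ?P = [:-t, 1:] * pderiv Q + Q * pderiv [:-t, 1:]" unfolding Q by (rule pderiv_mult)
  then have "poly Q t = 0" using d by (simp add: pderiv_pCons)
  then have "{x. poly ?P x = 0} \<subseteq> {x. poly Q x = 0}" unfolding Q by auto
  moreover have "Q \<noteq> 0" using Q legendre_poly_nonzero[of n] by (metis mult_zero_right)
  ultimately have "card {x. poly ?P x = 0} \<le> card {x. poly Q x = 0}"
    using poly_roots_finite[of Q] by (intro card_mono)
  then have "card {x. poly ?P x = 0} \<le> degree Q"
    using card_poly_roots_bound[OF \<open>Q \<noteq> 0\<close>] by linarith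
  moreover have "card {x. poly ?P x = 0} = n" using legendre_poly_roots[of n] by auto
  moreover have "degree ?P = Suc (degree Q)" unfolding Q using \<open>Q \<noteq> 0\<close> by (subst degree_mult_eq) auto
  ultimately show False using degree_legendre_poly[of n] by simp
qed

text \<open>Legendre's equation loses its leading term at \<open>1\<close> and \<open>-1\<close>, so
  \<open>P' = 0\<close> would force \<open>P = 0\<close> there, whereas all zeros of
  \<open>P\<close> lie strictly inside.\<close>

lemma pderiv_legendre_poly_pole:
  assumes "t\<^sup>2 = 1" "n > 0"
  shows "poly (pderiv (legendre_poly n)) t \<noteq> 0"
proof
  assume "poly (pderiv (legendre_poly n)) t = 0"
  then have "poly (legendre_poly n) t = 0" using legendre_ode[of t n] assms by simp
  then have "t \<in> {-1<..<1}" using legendre_poly_roots[of n] by blast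
  then show False using assms(1) abs_square_less_1[of t] by auto
qed

section \<open>The polynomial n P - t P' and its zeros\<close>

text \<open>The operator \<open>n - t d/dt\<close> applied to \<open>P\<close>: it multiplies the
  coefficient of \<open>t^k\<close> by \<open>n - k\<close> and so cancels the leading one. For
  \<open>n = 2 * r\<close> its zeros in \<open>(0,1)\<close> define \<open>omega\<close>.\<close>

definition legendre_defect :: "nat \<Rightarrow> real poly" where
  "legendre_defect n = smult (real n) (legendre_poly n) - [:0, 1:] * pderiv (legendre_poly n)"

lemma poly_legendre_defect:
  "poly (legendre_defect n) t =
    real n * poly (legendre_poly n) t - t * poly (pderiv (legendre_poly n)) t"
  by (simp add: legendre_defect_def)

lemma legendre_poly_even_coeff:
  assumes "even n" "odd k"
  shows "coeff (legendre_poly n) k = 0"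
proof -
  have "pcompose (legendre_poly n) [:0, -1:] = legendre_poly n"
    using legendre_poly_minus[of n] assms(1) by (intro poly_ext) (simp add: poly_pcompose)
  then have "coeff (pcompose (legendre_poly n) [:0, -1:]) k = coeff (legendre_poly n) k" by simp
  then show ?thesis using assms(2) by (simp add: coeff_pcompose_linear)
qed

lemma pderiv_legendre_poly_minus:
  assumes "even n"
  shows "poly (pderiv (legendre_poly n)) (- t) = - poly (pderiv (legendre_poly n)) t"
proof -
  let ?P = "legendre_poly n"
  have "pcompose ?P [:0, -1:] = ?P"
    using legendre_poly_minus[of n] assms by (intro poly_ext) (simp add: poly_pcompose)
  then have "pderiv (pcompose ?P [:0, -1:]) = pderiv ?P" by simp
  then have "poly (- pcompose (pderiv ?P) [:0, -1:]) t = poly (pderiv ?P) t"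
    by (simp add: pderiv_pcompose pderiv_pCons)
  then show ?thesis by (simp add: poly_pcompose)
qed

lemma coeff_legendre_defect:
  "coeff (legendre_defect n) k = (real n - real k) * coeff (legendre_poly n) k"
  by (cases k) (simp_all add: legendre_defect_def coeff_pderiv algebra_simps)

lemma symmetric_card:
  fixes A :: "real set"
  assumes "finite A" "\<And>x. x \<in> A \<Longrightarrow> - x \<in> A" "0 \<notin> A"
  shows "card A = 2 * card {x\<in>A. x > 0}"
proof -
  have "uminus ` {x\<in>A. x > 0} = {x\<in>A. x < 0}"
  proof (intro equalityI subsetI)
    fix x assume "x \<in> {x\<in>A. x < 0}"
    then show "x \<in> uminus ` {x\<in>A. x > 0}" using assms(2) by (intro image_eqI[of _ _ "-x"]) auto
  qed (use assms(2) in auto)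
  then have "card {x\<in>A. x < 0} = card {x\<in>A. x > 0}" using card_image[of uminus "{x\<in>A. x > 0}"] by simp
  moreover have "A = {x\<in>A. x > 0} \<union> {x\<in>A. x < 0}" using assms(3) by (auto) (metis linorder_less_linear)
  moreover have "card ({x\<in>A. x > 0} \<union> {x\<in>A. x < 0}) = card {x\<in>A. x > 0} + card {x\<in>A. x < 0}"
    using assms(1) by (intro card_Un_disjoint) auto
  ultimately show ?thesis by simp
qed

text \<open>\<open>P'\<close> is odd and vanishes at \<open>0\<close>, so a zero of \<open>P\<close>
  there would be double.\<close>

lemma legendre_poly_even_nonzero_0:
  assumes "even n"
  shows "poly (legendre_poly n) 0 \<noteq> 0"
proof
  assume "poly (legendre_poly n) 0 = 0"
  then have "poly (pderiv (legendre_poly n)) 0 \<noteq> 0" by (rule legendre_poly_simple_root)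
  then show False using pderiv_legendre_poly_minus[OF assms, of 0] by simp
qed

lemma legendre_defect_nonzero:
  assumes "even n" "n > 0"
  shows "legendre_defect n \<noteq> 0"
proof
  assume "legendre_defect n = 0"
  then have "poly (legendre_defect n) 0 = 0" by simp
  then show False using legendre_poly_even_nonzero_0[OF assms(1)] assms(2)
    by (simp add: poly_legendre_defect)
qed

text \<open>Rolle's theorem for \<open>t\<^sup>-\<^sup>2\<^sup>r P\<^sub>2\<^sub>r\<close> gives the lower bound. The polynomial
  is even and its two top coefficients vanish, which gives the upper bound.\<close>

theorem card_legendre_defect_roots:
  assumes "r \<ge> 1"
  shows "card {t. 0 < t \<and> t < 1 \<and> poly (legendre_defect (2 * r)) t = 0} = r - 1"
proof -
  let ?P = "legendre_poly (2 * r)" and ?g = "legendre_defect (2 * r)"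
  obtain Z where Z: "finite Z" "card Z = 2 * r" "Z \<subseteq> {-1<..<1}" "Z = {x. poly ?P x = 0}"
    using legendre_poly_roots[of "2 * r"] by blast
  have "card Z = 2 * card {x\<in>Z. x > 0}"
    using Z(1) legendre_poly_minus[of "2 * r"] legendre_poly_even_nonzero_0[of "2 * r"]
    by (intro symmetric_card) (auto simp: Z(4))
  then have cZ: "card {x\<in>Z. x > 0} = Suc (r - 1)" using Z(2) assms by simp
  let ?S = "{x\<in>Z. x > 0}"
  have S: "finite ?S" using Z(1) by simp
  moreover have "?S \<noteq> {}" using cZ by (metis card.empty nat.distinct(1))
  ultimately have MS: "Min ?S \<in> ?S" "Max ?S \<in> ?S" using Min_in Max_in by blast+
  then have Sin: "0 < Min ?S" "Max ?S < 1" using Z(3) by auto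
  define f f' where "f t = poly ?P t / t ^ (2 * r)" and
    "f' t = - poly ?g t / t ^ (2 * r + 1)" for t
  have "(f has_real_derivative f' t) (at t)" if "t > 0" for t
  proof -
    have "(f has_real_derivative
        (poly (pderiv ?P) t * t ^ (2 * r) - poly ?P t * (real (2 * r) * t ^ (2 * r - 1)))
          / (t ^ (2 * r) * t ^ (2 * r))) (at t)"
      unfolding f_def using that by (auto intro!: derivative_eq_intros)
    moreover have "t ^ (2 * r) = t * t ^ (2 * r - 1)"
      using assms by (cases "2 * r") simp_all
    then have "(poly (pderiv ?P) t * t ^ (2 * r) - poly ?P t * (real (2 * r) * t ^ (2 * r - 1)))
          / (t ^ (2 * r) * t ^ (2 * r)) = f' t"
      using that by (simp add: f'_def poly_legendre_defect field_simps)
    ultimately show ?thesis by simp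
  qed
  then obtain T where T: "finite T" "card T = r - 1" "T \<subseteq> {Min ?S<..<Max ?S}" "\<forall>x\<in>T. f' x = 0"
    using Rolle_finite_set[OF S cZ, of f f'] Sin Z(4) by (auto simp: f_def)
  let ?R = "{t. 0 < t \<and> t < 1 \<and> poly ?g t = 0}"
  have g0: "?g \<noteq> 0" using legendre_defect_nonzero assms by simp
  have fin: "finite {t. poly ?g t = 0}" using poly_roots_finite[OF g0] .
  have "T \<subseteq> ?R" using T(3,4) Sin by (fastforce simp: f'_def)
  then have "r - 1 \<le> card ?R" using T(2) card_mono[of ?R T] fin
    by (metis (mono_tags, lifting) finite_subset mem_Collect_eq subsetI)
  \<comment> \<open>The zeros of \<open>?g\<close> are symmetric and avoid \<open>0\<close>, so the
    degree bound \<open>2 * r - 2\<close> leaves at most \<open>r - 1\<close> positive ones.\<close>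
  moreover have "card {t. poly ?g t = 0} = 2 * card {t \<in> {t. poly ?g t = 0}. t > 0}"
    using fin legendre_poly_minus[of "2 * r"] pderiv_legendre_poly_minus[of "2 * r"]
      legendre_poly_even_nonzero_0[of "2 * r"] assms
    by (intro symmetric_card) (auto simp: poly_legendre_defect)
  moreover have "card ?R \<le> card {t \<in> {t. poly ?g t = 0}. t > 0}"
    using fin by (intro card_mono) auto
  moreover have "card {t. poly ?g t = 0} \<le> 2 * r - 2"
  proof -
    have "degree ?g \<le> 2 * r - 2"
    proof (rule degree_le, intro allI impI)
      fix k assume k: "2 * r - 2 < k"
      then consider "k = 2 * r - 1" | "k = 2 * r" | "k > 2 * r" by linarith
      then show "coeff ?g k = 0"
        using assms coeff_eq_0[of ?P k] legendre_poly_even_coeff[of "2 * r" k]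
        by cases (auto simp: coeff_legendre_defect degree_legendre_poly)
    qed
    then show ?thesis using card_poly_roots_bound[OF g0] by simp
  qed
  ultimately show ?thesis by linarith
qed

section \<open>The meridians of critical zeros\<close>

text \<open>The function \<open>f\<close> of the statement, which is the numerator of the derivative
  of \<open>sin (2 * r * \<phi>) / sin (\<phi> - \<alpha>)\<close>.\<close>

definition meridian_fun :: "nat \<Rightarrow> real \<Rightarrow> real \<Rightarrow> real" where
  "meridian_fun r \<alpha> \<phi> =
    2 * real r * cos (2 * real r * \<phi>) * sin (\<phi> - \<alpha>) - sin (2 * real r * \<phi>) * cos (\<phi> - \<alpha>)"

text \<open>The products of cosines cancel. What remains is a single product of sines, whose sign
  can be read off on each interval.\<close>

lemma meridian_fun_deriv:
  "(meridian_fun r \<alpha> has_real_derivative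
    (1 - (2 * real r)\<^sup>2) * sin (2 * real r * \<phi>) * sin (\<phi> - \<alpha>)) (at \<phi>)"
  unfolding meridian_fun_def[abs_def]
  by (auto intro!: derivative_eq_intros simp: algebra_simps power2_eq_square)

lemma meridian_fun_add_pi: "meridian_fun r \<alpha> (\<phi> + pi) = - meridian_fun r \<alpha> \<phi>"
proof -
  have "2 * real r * (\<phi> + pi) = 2 * real r * \<phi> + 2 * real r * pi" by (simp add: algebra_simps)
  then have "sin (2 * real r * (\<phi> + pi)) = sin (2 * real r * \<phi>)"
    "cos (2 * real r * (\<phi> + pi)) = cos (2 * real r * \<phi>)"
    by (simp_all add: sin_add cos_add)
  moreover have "\<phi> + pi - \<alpha> = (\<phi> - \<alpha>) + pi" by simp
  ultimately show ?thesis unfolding meridian_fun_def by (simp only: sin_periodic_pi cos_periodic_pi)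
qed

lemma meridian_fun_grid:
  assumes "r \<ge> 1"
  shows "meridian_fun r \<alpha> (real k * pi / (2 * real r)) = 2 * real r * (-1) ^ k * sin (real k * pi / (2 * real r) - \<alpha>)"
proof -
  have "2 * real r * (real k * pi / (2 * real r)) = real k * pi" using assms by simp
  then show ?thesis by (simp only: meridian_fun_def cos_npi sin_npi)
qed

lemma sin_nonzero_between_grid:
  assumes "r \<ge> 1" "real j * pi / (2 * real r) < \<phi>" "\<phi> < real (j + 1) * pi / (2 * real r)"
  shows "sin (2 * real r * \<phi>) \<noteq> 0"
proof
  assume "sin (2 * real r * \<phi>) = 0"
  then obtain i :: int where i: "2 * real r * \<phi> = real_of_int i * pi" using sin_zero_iff_int2 by blast
  have "real j * pi < 2 * real r * \<phi>" "2 * real r * \<phi> < real (j + 1) * pi"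
    using assms by (simp_all add: field_simps)
  then have "real j < real_of_int i" "real_of_int i < real (j + 1)"
    unfolding i by (simp_all only: mult_less_cancel_right_pos pi_gt_zero)
  then have "int j < i" "i < int (j + 1)" by linarith+
  then show False by linarith
qed

section \<open>Locating all zeros of the meridian function\<close>

context
  fixes r :: nat and \<alpha> :: real
  assumes r: "r \<ge> 1" and \<alpha>: "0 < \<alpha>" "\<alpha> < pi / (2 * real r)"
begin

lemma sin_grid_pos:
  assumes "1 \<le> k" "k \<le> 2 * r"
  shows "0 < sin (real k * pi / (2 * real r) - \<alpha>)"
proof (rule sin_gt_zero)
  have "1 * pi / (2 * real r) \<le> real k * pi / (2 * real r)"
    using assms(1) by (intro divide_right_mono mult_right_mono) auto
  then show "0 < real k * pi / (2 * real r) - \<alpha>" using \<alpha> by simp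
  have "real k * pi / (2 * real r) \<le> real (2 * r) * pi / (2 * real r)"
    using assms(2) by (intro divide_right_mono mult_right_mono) auto
  then show "real k * pi / (2 * real r) - \<alpha> < pi" using \<alpha> r by simp
qed

lemma meridian_fun_grid_nonzero:
  assumes "1 \<le> k" "k \<le> 2 * r"
  shows "meridian_fun r \<alpha> (real k * pi / (2 * real r)) \<noteq> 0"
  using sin_grid_pos[OF assms] r by (simp add: meridian_fun_grid)

text \<open>At the grid points the cosine is \<open>(-1) ^ k\<close> while
  \<open>sin (\<phi> - \<alpha>)\<close> stays positive, so the signs at the two ends are opposite.
  Inside the interval no factor of the derivative vanishes, and Rolle's theorem forbids a second
  zero.\<close>

lemma meridian_fun_ex1:
  assumes j: "j \<in> {1..2 * r - 1}"
  shows "\<exists>!\<phi>. real j * pi / (2 * real r) < \<phi> \<and> \<phi> < real (j + 1) * pi / (2 * real r) \<and>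
    meridian_fun r \<alpha> \<phi> = 0"
proof -
  define a b where "a = real j * pi / (2 * real r)" and "b = real (j + 1) * pi / (2 * real r)"
  have "a < b" using r by (simp add: a_def b_def field_simps)
  have "0 < sin (a - \<alpha>)" "0 < sin (b - \<alpha>)"
    using sin_grid_pos[of j] sin_grid_pos[of "j + 1"] j by (auto simp: a_def b_def)
  moreover have fa: "meridian_fun r \<alpha> a = 2 * real r * (-1) ^ j * sin (a - \<alpha>)"
    "meridian_fun r \<alpha> b = - (2 * real r * (-1) ^ j * sin (b - \<alpha>))"
    using meridian_fun_grid[OF r, of \<alpha> j] meridian_fun_grid[OF r, of \<alpha> "j + 1"]
    by (auto simp: a_def b_def)
  ultimately have sgn: "(meridian_fun r \<alpha> a < 0 \<and> 0 < meridian_fun r \<alpha> b) \<or>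
      (0 < meridian_fun r \<alpha> a \<and> meridian_fun r \<alpha> b < 0)"
    using r by (cases "even j") auto
  have "continuous_on {a..b} (meridian_fun r \<alpha>)"
    using meridian_fun_deriv by (intro DERIV_atLeastAtMost_imp_continuous_on) blast
  then obtain x where x: "a \<le> x" "x \<le> b" "meridian_fun r \<alpha> x = 0"
    using sgn IVT'[of "meridian_fun r \<alpha>" a 0 b] IVT2'[of "meridian_fun r \<alpha>" b 0 a] \<open>a < b\<close> by force
  have d: "(1 - (2 * real r)\<^sup>2) * sin (2 * real r * y) * sin (y - \<alpha>) \<noteq> 0" if y: "a < y" "y < b" for y
  proof -
    have "2 \<le> 2 * real r" using r by simp
    then have "2\<^sup>2 \<le> (2 * real r)\<^sup>2" by (intro power_mono) auto
    then have "1 - (2 * real r)\<^sup>2 \<noteq> 0" by simp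
    moreover have "sin (2 * real r * y) \<noteq> 0"
      using sin_nonzero_between_grid[OF r, of j y] y by (simp add: a_def b_def)
    moreover have "0 < sin (y - \<alpha>)"
    proof (rule sin_gt_zero)
      have "1 * pi / (2 * real r) \<le> a" unfolding a_def using j
        by (intro divide_right_mono mult_right_mono) auto
      then show "0 < y - \<alpha>" using \<alpha> y by simp
      have "b \<le> real (2 * r) * pi / (2 * real r)" unfolding b_def using j
        by (intro divide_right_mono mult_right_mono) auto
      then show "y - \<alpha> < pi" using y \<alpha> r by simp
    qed
    ultimately show ?thesis by simp
  qed
  have uniq: "\<not> y < z" if "a < y" "z < b" "meridian_fun r \<alpha> y = 0" "meridian_fun r \<alpha> z = 0" for y z
  proof
    assume "y < z"
    have "\<exists>w. y < w \<and> w < z \<and> DERIV (meridian_fun r \<alpha>) w :> 0"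
    proof (rule Rolle[OF \<open>y < z\<close>])
      show "continuous_on {y..z} (meridian_fun r \<alpha>)"
        using meridian_fun_deriv by (intro DERIV_atLeastAtMost_imp_continuous_on) blast
      show "meridian_fun r \<alpha> differentiable at x" for x
        unfolding real_differentiable_def using meridian_fun_deriv by blast
    qed (use that in simp)
    then obtain w where w: "y < w" "w < z" "DERIV (meridian_fun r \<alpha>) w :> 0" by blast
    then show False using DERIV_unique[OF meridian_fun_deriv w(3)] d[of w] that by simp
  qed
  have "a \<noteq> x" "x \<noteq> b" using x(3) sgn by auto
  then have "a < x" "x < b" using x by auto
  then show ?thesis
    unfolding a_def[symmetric] b_def[symmetric] using x(3) uniq
    by (intro ex1I[of _ x]) (auto, meson linorder_less_linear)
qed

lemma phi_zero:
  assumes "j \<in> {1..2 * r - 1}"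
  shows "real j * pi / (2 * real r) < phi r \<alpha> j" "phi r \<alpha> j < real (j + 1) * pi / (2 * real r)"
    "meridian_fun r \<alpha> (phi r \<alpha> j) = 0"
  using theI'[OF meridian_fun_ex1[OF assms]] unfolding phi_def meridian_fun_def by blast+

lemma phi_eqI:
  assumes "j \<in> {1..2 * r - 1}" "real j * pi / (2 * real r) < \<phi>" "\<phi> < real (j + 1) * pi / (2 * real r)"
    "meridian_fun r \<alpha> \<phi> = 0"
  shows "phi r \<alpha> j = \<phi>"
  using meridian_fun_ex1[OF assms(1)] phi_zero[OF assms(1)] assms by blast

text \<open>On the first interval the function increases up to \<open>\<alpha>\<close>, where it is negative, and then
  decreases.\<close>

lemma meridian_fun_first_interval:
  assumes "0 \<le> \<phi>" "\<phi> \<le> pi / (2 * real r)"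
  shows "meridian_fun r \<alpha> \<phi> < 0"
proof -
  have sgn: "0 \<le> sin (2 * real r * x)" if "0 \<le> x" "x \<le> pi / (2 * real r)" for x
    using that r by (intro sin_ge_zero) (auto simp: field_simps)
  have c: "1 - (2 * real r)\<^sup>2 \<le> 0"
  proof -
    have "1\<^sup>2 \<le> (2 * real r)\<^sup>2" using r by (intro power_mono) auto
    then show ?thesis by simp
  qed
  have pi: "pi / (2 * real r) \<le> pi" using r by (simp add: field_simps)
  have "0 < sin (2 * real r * \<alpha>)"
    using \<alpha> r by (intro sin_gt_zero) (auto simp: field_simps)
  then have neg: "meridian_fun r \<alpha> \<alpha> < 0" by (simp add: meridian_fun_def)
  show ?thesis
  proof (cases "\<phi> \<le> \<alpha>")
    case True
    have "meridian_fun r \<alpha> \<phi> \<le> meridian_fun r \<alpha> \<alpha>"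
    proof (rule DERIV_nonneg_imp_nondecreasing[OF True], intro exI conjI)
      fix x assume x: "\<phi> \<le> x" "x \<le> \<alpha>"
      have "0 \<le> sin (\<alpha> - x)" using x assms \<alpha> pi by (intro sin_ge_zero) auto
      moreover have "sin (x - \<alpha>) = - sin (\<alpha> - x)" by (metis minus_diff_eq sin_minus)
      ultimately show "0 \<le> (1 - (2 * real r)\<^sup>2) * sin (2 * real r * x) * sin (x - \<alpha>)"
        using c sgn[of x] x assms \<alpha>
        by (intro mult_nonpos_nonpos mult_nonpos_nonneg) auto
    qed (rule meridian_fun_deriv)
    then show ?thesis using neg by simp
  next
    case False
    then have "meridian_fun r \<alpha> \<phi> \<le> meridian_fun r \<alpha> \<alpha>"
    proof (intro DERIV_nonpos_imp_nonincreasing[of \<alpha> \<phi>] exI conjI)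
      fix x assume x: "\<alpha> \<le> x" "x \<le> \<phi>"
      have "0 \<le> sin (x - \<alpha>)" using x assms \<alpha> pi by (intro sin_ge_zero) auto
      then show "(1 - (2 * real r)\<^sup>2) * sin (2 * real r * x) * sin (x - \<alpha>) \<le> 0"
        using c sgn[of x] x assms \<alpha>
        by (intro mult_nonpos_nonneg) auto
    qed (use meridian_fun_deriv in auto)
    then show ?thesis using neg by simp
  qed
qed

text \<open>Completeness of the list \<open>phi\<close>: the interval with index \<open>0\<close>
  contains no zero, and no grid point is one, so the integer part of
  \<open>2 * r * \<phi> / pi\<close> is an admissible index.\<close>

lemma meridian_fun_zeros_half:
  assumes "0 \<le> \<phi>" "\<phi> < pi" "meridian_fun r \<alpha> \<phi> = 0"
  shows "\<exists>j\<in>{1..2 * r - 1}. \<phi> = phi r \<alpha> j"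
proof -
  define j where "j = nat \<lfloor>2 * real r * \<phi> / pi\<rfloor>"
  have jr: "real j = \<lfloor>2 * real r * \<phi> / pi\<rfloor>" using assms r by (simp add: j_def)
  have "real j \<le> 2 * real r * \<phi> / pi" "2 * real r * \<phi> / pi < real j + 1" unfolding jr by linarith+
  then have bounds: "real j * pi / (2 * real r) \<le> \<phi>" "\<phi> < real (j + 1) * pi / (2 * real r)"
    using r by (simp_all add: field_simps)
  have "pi / (2 * real r) < \<phi>" using meridian_fun_first_interval[OF assms(1)] assms(3) by force
  then have "1 * pi / (2 * real r) < real (j + 1) * pi / (2 * real r)" using bounds by simp
  then have "1 \<le> j" using r by (cases j) (simp_all add: field_simps)
  have "real j * pi / (2 * real r) < pi" using bounds assms by simp
  then have "real j * pi < real (2 * r) * pi" using r by (simp add: pos_divide_less_eq mult.commute)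
  then have "real j < real (2 * r)" by (simp only: mult_less_cancel_right_pos pi_gt_zero)
  then have j: "j \<in> {1..2 * r - 1}" using \<open>1 \<le> j\<close> by auto
  have "\<phi> \<noteq> real j * pi / (2 * real r)" using meridian_fun_grid_nonzero[of j] \<open>1 \<le> j\<close> \<open>real j < _\<close> assms(3)
    by auto
  then show ?thesis using phi_eqI[OF j, of \<phi>] bounds assms(3) j by force
qed

lemma meridian_fun_zeros:
  assumes "0 \<le> \<phi>" "\<phi> < 2 * pi" "meridian_fun r \<alpha> \<phi> = 0"
  shows "\<exists>j\<in>{1..2 * r - 1}. \<phi> = phi r \<alpha> j \<or> \<phi> = phi r \<alpha> j + pi"
proof (cases "\<phi> < pi")
  case True
  then show ?thesis using meridian_fun_zeros_half assms by blast
next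
  case False
  then have "meridian_fun r \<alpha> (\<phi> - pi) = 0" using meridian_fun_add_pi[of r \<alpha> "\<phi> - pi"] assms(3) by simp
  then show ?thesis using meridian_fun_zeros_half[of "\<phi> - pi"] False assms(2) by force
qed

text \<open>If \<open>\<phi> - \<alpha>\<close> is a multiple of \<open>pi\<close>, then
  \<open>2 * r * \<phi>\<close> agrees with \<open>2 * r * \<alpha>\<close> modulo
  \<open>2 * pi\<close>, and the sine of the latter is positive by the bounds on
  \<open>\<alpha>\<close>.\<close>

lemma meridian_fun_zero_sin_nonzero:
  assumes "meridian_fun r \<alpha> \<phi> = 0"
  shows "sin (\<phi> - \<alpha>) \<noteq> 0"
proof
  assume s: "sin (\<phi> - \<alpha>) = 0"
  then obtain i :: int where i: "\<phi> - \<alpha> = real_of_int i * pi" using sin_zero_iff_int2 by blast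
  have "cos (\<phi> - \<alpha>) \<noteq> 0" using s sin_cos_squared_add[of "\<phi> - \<alpha>"] by auto
  then have "sin (2 * real r * \<phi>) = 0" using assms s by (simp add: meridian_fun_def)
  moreover have "2 * real r * \<phi> = 2 * real r * \<alpha> + 2 * pi * real_of_int (int r * i)"
    using i by (simp add: algebra_simps)
  moreover have "sin (2 * real r * \<alpha> + 2 * pi * real_of_int (int r * i)) = sin (2 * real r * \<alpha>)"
    unfolding sin_add sin_int_2pin cos_int_2pin by simp
  moreover have "0 < sin (2 * real r * \<alpha>)"
    using \<alpha> r by (intro sin_gt_zero) (auto simp: field_simps)
  ultimately show False by simp
qed

end

section \<open>Critical zeros in spherical coordinates\<close>

lemma regular_nodal_set_closed_curves:
  fixes u :: "real^3 \<Rightarrow> real" and a :: "real^3 \<Rightarrow> real^3"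
  assumes "\<And>x. (u has_derivative (\<lambda>h. a x \<bullet> h)) (at x)" "continuous_on UNIV a"
    and "\<And>p. p \<in> nodal_set u \<Longrightarrow> cross3 p (a p) \<noteq> 0"
  shows "\<exists>\<C>. finite \<C> \<and> disjoint \<C> \<and> (\<forall>C\<in>\<C>. simple_closed_curve C) \<and> nodal_set u = \<Union>\<C>"
proof (rule compact_locally_arc_imp_closed_curves)
  have "continuous_on UNIV u"
    by (rule has_derivative_continuous_on) (rule has_derivative_at_withinI[OF assms(1)])
  then have "closed (u -` {0})" by (intro closed_vimage) auto
  moreover have "nodal_set u = S2 \<inter> u -` {0}" by (auto simp: nodal_set_def)
  ultimately show "compact (nodal_set u)" by (simp add: compact_Int_closed)
qed (rule regular_zero_locally_arc[OF assms(1,2)]; use assms(3) in blast)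

text \<open>A derivative within the sphere is not determined in the normal direction. It is
  therefore compared with the gradient only along great circles \<open>c\<close> through
  \<open>p\<close>, which stay on the sphere.\<close>

lemma critical_zero_iff_gradient:
  assumes "(u has_derivative (\<lambda>h. a \<bullet> h)) (at p)"
  shows "critical_zero u p \<longleftrightarrow> p \<in> S2 \<and> u p = 0 \<and> (\<forall>v. p \<bullet> v = 0 \<longrightarrow> a \<bullet> v = 0)"
proof
  assume "critical_zero u p"
  then obtain D where p: "p \<in> S2" "u p = 0" and D: "(u has_derivative D) (at p within S2)"
    "\<forall>v. p \<bullet> v = 0 \<longrightarrow> D v = 0" by (auto simp: critical_zero_def)
  have "a \<bullet> v = 0" if v: "p \<bullet> v = 0" for v
  proof (cases "v = 0")
    case False
    define w where "w = v /\<^sub>R norm v"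
    have w: "w \<bullet> w = 1" "p \<bullet> w = 0" "v = norm v *\<^sub>R w"
      using False v by (simp_all add: w_def dot_square_norm power2_eq_square)
    define c where "c s = cos s *\<^sub>R p + sin s *\<^sub>R w" for s :: real
    have c0: "c 0 = p" by (simp add: c_def)
    have pp: "p \<bullet> p = 1" using p(1) by (simp add: dot_square_norm)
    have "c s \<bullet> c s = (cos s)\<^sup>2 + (sin s)\<^sup>2" for s
      using pp w by (simp add: c_def inner_add_left inner_add_right inner_commute power2_eq_square)
    then have cS: "range c \<subseteq> S2" by (auto simp: norm_eq_1)
    have dc: "(c has_derivative (\<lambda>t. t *\<^sub>R w)) (at 0)"
      unfolding c_def by (auto intro!: derivative_eq_intros)
    have "(u has_derivative D) (at (c 0) within range c)"
      using has_derivative_subset[OF D(1) cS] c0 by simp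
    then have "((\<lambda>s. u (c s)) has_derivative (\<lambda>t. D (t *\<^sub>R w))) (at 0)"
      using has_derivative_in_compose[OF dc] by simp
    moreover have "(u has_derivative (\<lambda>h. a \<bullet> h)) (at (c 0))" using assms c0 by simp
    from has_derivative_compose[OF dc this]
    have "((\<lambda>s. u (c s)) has_derivative (\<lambda>t. a \<bullet> (t *\<^sub>R w))) (at 0)" .
    ultimately have "(\<lambda>t. D (t *\<^sub>R w)) = (\<lambda>t. a \<bullet> (t *\<^sub>R w))" by (rule has_derivative_unique)
    then have "D (1 *\<^sub>R w) = a \<bullet> (1 *\<^sub>R w)" by (rule fun_cong)
    then have "a \<bullet> w = 0" using D(2) w(2) by simp
    then show ?thesis by (subst w(3)) simp
  qed simp
  then show "p \<in> S2 \<and> u p = 0 \<and> (\<forall>v. p \<bullet> v = 0 \<longrightarrow> a \<bullet> v = 0)" using p by blast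
next
  assume "p \<in> S2 \<and> u p = 0 \<and> (\<forall>v. p \<bullet> v = 0 \<longrightarrow> a \<bullet> v = 0)"
  then show "critical_zero u p"
    unfolding critical_zero_def using has_derivative_at_withinI[OF assms] by blast
qed

section \<open>The gradient of the spherical harmonic\<close>

text \<open>With \<open>z = x + i y\<close>, the partial derivatives of \<open>Im (z^n)\<close> are
  \<open>n Im (z^(n-1))\<close> in \<open>x\<close> and \<open>n Re (z^(n-1))\<close> in
  \<open>y\<close>; this is where \<open>w\<close> comes from.\<close>

definition gradH :: "nat \<Rightarrow> real \<Rightarrow> real \<Rightarrow> real^3 \<Rightarrow> real^3" where
  "gradH r \<alpha> \<mu> p =
    (let w = (complex_of_real (p $ 1) + \<i> * complex_of_real (p $ 2)) ^ (2 * r - 1);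
         q = pderiv (legendre_poly (2 * r)) in
      (2 * real r * Im w - \<mu> * sin \<alpha> * poly q (p $ 3)) *\<^sub>R axis 1 1
    + (2 * real r * Re w + \<mu> * cos \<alpha> * poly q (p $ 3)) *\<^sub>R axis 2 1
    + (\<mu> * (p $ 2 * cos \<alpha> - p $ 1 * sin \<alpha>) * poly (pderiv q) (p $ 3)) *\<^sub>R axis 3 1)"

lemma continuous_on_gradH: "continuous_on UNIV (gradH r \<alpha> \<mu>)"
  unfolding gradH_def Let_def
  by (intro continuous_intros)

lemma has_derivative_H: "(H r \<alpha> \<mu> has_derivative (\<lambda>h. gradH r \<alpha> \<mu> p \<bullet> h)) (at p)"
proof -
  let ?q = "pderiv (legendre_poly (2 * r))"
  let ?w = "(complex_of_real (p $ 1) + \<i> * complex_of_real (p $ 2)) ^ (2 * r - 1)"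
  have Heq: "H r \<alpha> \<mu> = (\<lambda>x. Im ((complex_of_real (x $ 1) + \<i> * complex_of_real (x $ 2)) ^ (2 * r))
      + \<mu> * ((x $ 2 * cos \<alpha> - x $ 1 * sin \<alpha>) * poly ?q (x $ 3)))"
    by (simp add: fun_eq_iff H_def W_def V_def Complex_eq algebra_simps)
  have nth: "((\<lambda>x. x $ i) has_derivative (\<lambda>h. h $ i)) (at p)" for i :: 3
    by (rule bounded_linear_imp_has_derivative[OF bounded_linear_vec_nth])
  have "(poly ?q has_derivative (\<lambda>h. poly (pderiv ?q) (p $ 3) * h)) (at (p $ 3))"
    using has_field_derivative_imp_has_derivative[OF poly_DERIV] .
  from has_derivative_compose[OF nth this]
  have dq: "((\<lambda>x. poly ?q (x $ 3)) has_derivative (\<lambda>h. poly (pderiv ?q) (p $ 3) * h $ 3)) (at p)" .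
  have grad: "gradH r \<alpha> \<mu> p \<bullet> h = Im (of_nat (2 * r) * (complex_of_real (h $ 1) + \<i> * complex_of_real (h $ 2)) * ?w)
      + \<mu> * ((p $ 2 * cos \<alpha> - p $ 1 * sin \<alpha>) * (poly (pderiv ?q) (p $ 3) * h $ 3)
           + (h $ 2 * cos \<alpha> - h $ 1 * sin \<alpha>) * poly ?q (p $ 3))" for h
    by (simp add: gradH_def Let_def inner_add_left inner_axis' algebra_simps)
  show ?thesis
    unfolding Heq grad using dq
    by (auto intro!: derivative_eq_intros nth simp: mult_ac)
qed

text \<open>The two vectors are the unit tangents along the parallel and along the meridian. The
  first formula is the \<open>\<phi>\<close>-derivative already divided by
  \<open>sin \<theta>\<close>.\<close>

lemma gradH_tangent:
  assumes "r \<ge> 1"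
  defines "q \<equiv> pderiv (legendre_poly (2 * r))"
  shows "gradH r \<alpha> \<mu> (sph \<theta> \<phi>) \<bullet> vector [- sin \<phi>, cos \<phi>, 0]
      = 2 * real r * sin \<theta> ^ (2 * r - 1) * cos (2 * real r * \<phi>) + \<mu> * poly q (cos \<theta>) * cos (\<phi> - \<alpha>)" (is ?A)
    "gradH r \<alpha> \<mu> (sph \<theta> \<phi>) \<bullet> vector [cos \<theta> * cos \<phi>, cos \<theta> * sin \<phi>, - sin \<theta>]
      = cos \<theta> * (2 * real r * sin \<theta> ^ (2 * r - 1) * sin (2 * real r * \<phi>) + \<mu> * poly q (cos \<theta>) * sin (\<phi> - \<alpha>))
        - (sin \<theta>)\<^sup>2 * \<mu> * poly (pderiv q) (cos \<theta>) * sin (\<phi> - \<alpha>)" (is ?B)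
proof -
  have n: "2 * real r * \<phi> = real (2 * r - 1) * \<phi> + \<phi>" using assms by (simp add: of_nat_diff algebra_simps)
  have "complex_of_real (sin \<theta> * cos \<phi>) + \<i> * complex_of_real (sin \<theta> * sin \<phi>) = complex_of_real (sin \<theta>) * cis \<phi>"
    by (simp add: complex_eq_iff)
  then have w: "(complex_of_real (sin \<theta> * cos \<phi>) + \<i> * complex_of_real (sin \<theta> * sin \<phi>)) ^ (2 * r - 1)
      = complex_of_real (sin \<theta> ^ (2 * r - 1)) * cis (real (2 * r - 1) * \<phi>)"
    by (simp only: power_mult_distrib Complex.DeMoivre of_real_power)
  show ?A ?B
    unfolding gradH_def Let_def sph_nth w q_def[symmetric] n
    by (simp_all add: inner_vec_def sum_3 vector_3 axis_def cos_add sin_add sin_diff cos_diff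
        power2_eq_square algebra_simps)
qed

section \<open>Spherical coordinates, tangent frames and the poles\<close>

lemma sph_in_S2: "sph \<theta> \<phi> \<in> S2"
proof -
  have "sin \<theta> * sin \<theta> + cos \<theta> * cos \<theta> = 1" "sin \<phi> * sin \<phi> + cos \<phi> * cos \<phi> = 1"
    using sin_cos_squared_add by (simp_all only: power2_eq_square)
  then have "sph \<theta> \<phi> \<bullet> sph \<theta> \<phi> = 1"
    unfolding inner_vec_def sum_3 sph_nth inner_real_def by algebra
  then show ?thesis by (simp add: norm_eq_1)
qed

lemma S2_sph:
  assumes "p \<in> S2"
  obtains \<theta> \<phi> where "0 \<le> \<theta>" "\<theta> \<le> pi" "0 \<le> \<phi>" "\<phi> < 2 * pi" "p = sph \<theta> \<phi>"
proof -
  have n: "(p $ 1)\<^sup>2 + (p $ 2)\<^sup>2 + (p $ 3)\<^sup>2 = 1"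
    using assms by (simp add: norm_eq_1 inner_vec_def sum_3 power2_eq_square)
  then have "(p $ 3)\<^sup>2 \<le> 1" by (smt (verit) zero_le_power2)
  then have z: "\<bar>p $ 3\<bar> \<le> 1" by (simp add: abs_square_le_1)
  define \<theta> where "\<theta> = arccos (p $ 3)"
  have \<theta>: "0 \<le> \<theta>" "\<theta> \<le> pi" "cos \<theta> = p $ 3" using z by (simp_all add: \<theta>_def arccos_lbound arccos_ubound)
  have s2: "(sin \<theta>)\<^sup>2 = (p $ 1)\<^sup>2 + (p $ 2)\<^sup>2" using n sin_squared_eq[of \<theta>] \<theta>(3) by simp
  show thesis
  proof (cases "sin \<theta> = 0")
    case True
    then have "(p $ 1)\<^sup>2 + (p $ 2)\<^sup>2 = 0" using s2 by simp
    then have "p $ 1 = 0" "p $ 2 = 0" by (simp_all only: sum_power2_eq_zero_iff)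
    then have "p = sph \<theta> 0" using True \<theta>(3) by (simp add: vec_eq_iff forall_3)
    then show thesis using that[of \<theta> 0] \<theta> by simp
  next
    case False
    have "(p $ 1 / sin \<theta>)\<^sup>2 + (p $ 2 / sin \<theta>)\<^sup>2 = 1"
      unfolding power_divide add_divide_distrib[symmetric] s2[symmetric] using False by simp
    then obtain \<phi> where \<phi>: "0 \<le> \<phi>" "\<phi> < 2 * pi" "p $ 1 / sin \<theta> = cos \<phi>" "p $ 2 / sin \<theta> = sin \<phi>"
      using sincos_total_2pi by metis
    then have "p = sph \<theta> \<phi>" using False \<theta>(3) by (simp add: vec_eq_iff forall_3 field_simps)
    then show thesis using that \<theta> \<phi> by blast
  qed
qed

lemma tangent_frame:
  assumes "sph \<theta> \<phi> \<bullet> v = 0"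
  defines "v1 \<equiv> vector [- sin \<phi>, cos \<phi>, 0] :: real^3"
    and "v2 \<equiv> vector [cos \<theta> * cos \<phi>, cos \<theta> * sin \<phi>, - sin \<theta>] :: real^3"
  shows "v = (v \<bullet> v1) *\<^sub>R v1 + (v \<bullet> v2) *\<^sub>R v2"
proof -
  have t: "sin \<theta> * cos \<phi> * v $ 1 + sin \<theta> * sin \<phi> * v $ 2 + cos \<theta> * v $ 3 = 0"
    using assms(1) by (simp add: inner_vec_def sum_3)
  have cs: "sin \<theta> * sin \<theta> + cos \<theta> * cos \<theta> = 1" "sin \<phi> * sin \<phi> + cos \<phi> * cos \<phi> = 1"
    using sin_cos_squared_add by (simp_all only: power2_eq_square)
  define a b where "a = v \<bullet> v1" and "b = v \<bullet> v2"
  have a: "a = - (v $ 1 * sin \<phi>) + v $ 2 * cos \<phi>"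
    by (simp add: a_def v1_def inner_vec_def sum_3 vector_3)
  have b: "b = v $ 1 * (cos \<theta> * cos \<phi>) + v $ 2 * (cos \<theta> * sin \<phi>) - v $ 3 * sin \<theta>"
    by (simp add: b_def v2_def inner_vec_def sum_3 vector_3)
  have "v $ 1 = - (a * sin \<phi>) + b * (cos \<theta> * cos \<phi>)"
    unfolding a b using t cs by algebra
  moreover have "v $ 2 = a * cos \<phi> + b * (cos \<theta> * sin \<phi>)"
    unfolding a b using t cs by algebra
  moreover have "v $ 3 = - (b * sin \<theta>)"
    unfolding a b using t cs by algebra
  ultimately show ?thesis
    unfolding a_def[symmetric] b_def[symmetric]
    by (simp add: vec_eq_iff forall_3 v1_def v2_def vector_3)
qed

lemma critical_zero_sph_iff:
  assumes "r \<ge> 1" "sin \<theta> \<noteq> 0"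
  defines "q \<equiv> pderiv (legendre_poly (2 * r))"
  shows "critical_zero (H r \<alpha> \<mu>) (sph \<theta> \<phi>) \<longleftrightarrow>
    sin \<theta> ^ (2 * r - 1) * sin (2 * real r * \<phi>) + \<mu> * poly q (cos \<theta>) * sin (\<phi> - \<alpha>) = 0 \<and>
    2 * real r * sin \<theta> ^ (2 * r - 1) * cos (2 * real r * \<phi>) + \<mu> * poly q (cos \<theta>) * cos (\<phi> - \<alpha>) = 0 \<and>
    cos \<theta> * (2 * real r * sin \<theta> ^ (2 * r - 1) * sin (2 * real r * \<phi>) + \<mu> * poly q (cos \<theta>) * sin (\<phi> - \<alpha>))
        - (sin \<theta>)\<^sup>2 * \<mu> * poly (pderiv q) (cos \<theta>) * sin (\<phi> - \<alpha>) = 0"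
proof -
  have "sin \<theta> ^ (2 * r) = sin \<theta> * sin \<theta> ^ (2 * r - 1)" using assms(1) by (cases "2 * r") simp_all
  then have "H r \<alpha> \<mu> (sph \<theta> \<phi>) = sin \<theta> * (sin \<theta> ^ (2 * r - 1) * sin (2 * real r * \<phi>) + \<mu> * poly q (cos \<theta>) * sin (\<phi> - \<alpha>))"
    unfolding H_sph q_def by (simp add: algebra_simps)
  then have H0: "H r \<alpha> \<mu> (sph \<theta> \<phi>) = 0 \<longleftrightarrow>
      sin \<theta> ^ (2 * r - 1) * sin (2 * real r * \<phi>) + \<mu> * poly q (cos \<theta>) * sin (\<phi> - \<alpha>) = 0"
    using assms(2) by simp
  let ?a = "gradH r \<alpha> \<mu> (sph \<theta> \<phi>)"
  let ?v1 = "vector [- sin \<phi>, cos \<phi>, 0] :: real^3"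
  let ?v2 = "vector [cos \<theta> * cos \<phi>, cos \<theta> * sin \<phi>, - sin \<theta>] :: real^3"
  have cs: "sin \<theta> * sin \<theta> + cos \<theta> * cos \<theta> = 1" "sin \<phi> * sin \<phi> + cos \<phi> * cos \<phi> = 1"
    using sin_cos_squared_add by (simp_all only: power2_eq_square)
  have "sph \<theta> \<phi> \<bullet> ?v1 = 0" by (simp add: inner_vec_def sum_3 vector_3)
  moreover have "sph \<theta> \<phi> \<bullet> ?v2 = 0"
    unfolding inner_vec_def sum_3 vector_3 sph_nth inner_real_def using cs by algebra
  moreover have "?a \<bullet> v = 0" if "sph \<theta> \<phi> \<bullet> v = 0" "?a \<bullet> ?v1 = 0" "?a \<bullet> ?v2 = 0" for v
    by (subst tangent_frame[OF that(1)]) (simp add: inner_add_right that)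
  ultimately have "(\<forall>v. sph \<theta> \<phi> \<bullet> v = 0 \<longrightarrow> ?a \<bullet> v = 0) \<longleftrightarrow> ?a \<bullet> ?v1 = 0 \<and> ?a \<bullet> ?v2 = 0"
    by blast
  then show ?thesis
    unfolding critical_zero_iff_gradient[OF has_derivative_H] H0 gradH_tangent[OF assms(1)] q_def
    using sph_in_S2 by blast
qed

text \<open>At a pole \<open>W\<close> vanishes to order \<open>2 * r\<close>, which is at least
  two, so only \<open>V\<close> contributes to the gradient. Along the horizontal direction of
  longitude \<open>\<alpha> + pi / 2\<close> the derivative is \<open>\<mu>\<close> times the
  nonzero value of \<open>P'\<close> at the pole.\<close>

lemma not_critical_zero_pole:
  assumes "r \<ge> 1" "\<mu> > 0" "sin \<theta> = 0"
  shows "\<not> critical_zero (H r \<alpha> \<mu>) (sph \<theta> \<phi>)"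
proof
  assume crit: "critical_zero (H r \<alpha> \<mu>) (sph \<theta> \<phi>)"
  let ?v = "vector [- sin \<alpha>, cos \<alpha>, 0] :: real^3"
  have "sph \<theta> \<phi> \<bullet> ?v = 0" using assms(3) by (simp add: inner_vec_def sum_3 vector_3)
  then have 0: "gradH r \<alpha> \<mu> (sph \<theta> \<phi>) \<bullet> ?v = 0"
    using crit unfolding critical_zero_iff_gradient[OF has_derivative_H] by blast
  let ?Q = "poly (pderiv (legendre_poly (2 * r))) (cos \<theta>)"
  have w: "(complex_of_real (0 * cos \<phi>) + \<i> * complex_of_real (0 * sin \<phi>)) ^ (2 * r - 1) = 0"
    using assms(1) by (simp add: power_0_left)
  have "gradH r \<alpha> \<mu> (sph \<theta> \<phi>) \<bullet> ?v = \<mu> * ?Q * ((sin \<alpha>)\<^sup>2 + (cos \<alpha>)\<^sup>2)"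
    unfolding gradH_def Let_def sph_nth assms(3) w inner_vec_def sum_3 vector_3 power2_eq_square
    by (simp add: axis_def distrib_left distrib_right mult.assoc mult.left_commute del: sin_cos_squared_add3)
  moreover have "(cos \<theta>)\<^sup>2 = 1" using assms(3) sin_cos_squared_add[of \<theta>] by simp
  then have "?Q \<noteq> 0"
    using assms(1) by (intro pderiv_legendre_poly_pole) auto
  ultimately show False using 0 assms(2) by simp
qed

text \<open>The root count fixes the length of the sorted list as \<open>r - 1\<close>, so every
  position \<open>i - 1\<close> read by \<open>omega\<close> is within range and every root is
  reached.\<close>

lemma omega_enum:
  assumes "r \<ge> 1"
  defines "R \<equiv> {t. 0 < t \<and> t < 1 \<and> poly (legendre_defect (2 * r)) t = 0}"
  shows "i \<in> {1..r - 1} \<Longrightarrow> cos (omega r i) \<in> R"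
    and "i \<in> {1..r - 1} \<Longrightarrow> 0 < omega r i \<and> omega r i < pi / 2"
    and "t \<in> R \<Longrightarrow> \<exists>i\<in>{1..r - 1}. omega r i = arccos t"
proof -
  define L where "L = rev (sorted_list_of_set R)"
  have "finite {t. poly (legendre_defect (2 * r)) t = 0}"
    using assms(1) by (intro poly_roots_finite legendre_defect_nonzero) auto
  then have "finite R" by (rule rev_finite_subset) (auto simp: R_def)
  then have L: "set L = R" "length L = r - 1"
    using card_legendre_defect_roots[OF assms(1)] by (simp_all add: L_def R_def)
  have om: "omega r i = arccos (L ! (i - 1))" for i
    unfolding omega_def L_def R_def poly_legendre_defect by simp
  show "cos (omega r i) \<in> R" "0 < omega r i \<and> omega r i < pi / 2" if "i \<in> {1..r - 1}"
  proof -
    have "i - 1 < length L" using that L(2) by auto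
    then have t: "L ! (i - 1) \<in> R" using nth_mem L(1) by blast
    then have t01: "0 < L ! (i - 1)" "L ! (i - 1) < 1" by (auto simp: R_def)
    then show "cos (omega r i) \<in> R" using t by (simp add: om)
    have "arccos 1 < omega r i" unfolding om using t01 by (intro arccos_less_arccos) auto
    moreover have "omega r i < arccos 0" unfolding om using t01 by (intro arccos_less_arccos) auto
    ultimately show "0 < omega r i \<and> omega r i < pi / 2" by simp
  qed
  show "\<exists>i\<in>{1..r - 1}. omega r i = arccos t" if t: "t \<in> R"
  proof -
    obtain k where "k < r - 1" "L ! k = t" using t L by (metis in_set_conv_nth)
    then show ?thesis by (intro bexI[of _ "Suc k"]) (auto simp: om)
  qed
qed

text \<open>If \<open>P'\<close> vanished as well, so would \<open>P\<close>, giving a double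
  zero.\<close>

lemma pderiv_legendre_poly_nonzero_at_defect_root:
  assumes "n > 0" "poly (legendre_defect n) t = 0"
  shows "poly (pderiv (legendre_poly n)) t \<noteq> 0"
  using assms legendre_poly_simple_root[of n t] by (auto simp: poly_legendre_defect)

section \<open>Separation of variables and classification of the critical zeros\<close>

context
  fixes r :: nat and \<alpha> :: real
  assumes r: "r \<ge> 1" and \<alpha>: "0 < \<alpha>" "\<alpha> < pi / (2 * real r)"
begin

lemma critical_zero_sph_separated:
  assumes "\<mu> > 0" "0 < sin \<theta>"
  shows "critical_zero (H r \<alpha> \<mu>) (sph \<theta> \<phi>) \<longleftrightarrow>
    meridian_fun r \<alpha> \<phi> = 0 \<and> poly (legendre_defect (2 * r)) (cos \<theta>) = 0 \<and>
    sin \<theta> ^ (2 * r - 1) * sin (2 * real r * \<phi>)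
      + \<mu> * poly (pderiv (legendre_poly (2 * r))) (cos \<theta>) * sin (\<phi> - \<alpha>) = 0"
proof -
  define S where "S = sin \<theta> ^ (2 * r - 1)"
  define n where "n = 2 * real r"
  define t where "t = cos \<theta>"
  define P P1 P2 where "P = poly (legendre_poly (2 * r)) t"
    and "P1 = poly (pderiv (legendre_poly (2 * r))) t"
    and "P2 = poly (pderiv (pderiv (legendre_poly (2 * r)))) t"
  define a b c d where "a = sin (n * \<phi>)" and "b = cos (n * \<phi>)" and "c = sin (\<phi> - \<alpha>)"
    and "d = cos (\<phi> - \<alpha>)"
  have "S \<noteq> 0" using assms(2) by (simp add: S_def)
  have "n + 1 \<noteq> 0" by (simp add: n_def)
  have ode: "(sin \<theta>)\<^sup>2 * P2 = 2 * t * P1 - n * (n + 1) * P"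
    using legendre_ode[of t "2 * r"] by (simp add: sin_squared_eq t_def P2_def P1_def P_def n_def)
  have f: "meridian_fun r \<alpha> \<phi> = n * b * c - a * d"
    by (simp add: meridian_fun_def n_def a_def b_def c_def d_def)
  have g: "poly (legendre_defect (2 * r)) (cos \<theta>) = n * P - t * P1"
    by (simp add: poly_legendre_defect t_def n_def P_def P1_def)
  have c0: "meridian_fun r \<alpha> \<phi> = 0 \<Longrightarrow> c \<noteq> 0"
    using meridian_fun_zero_sin_nonzero[OF r \<alpha>] by (simp add: c_def)
  have "(S * a + \<mu> * P1 * c = 0 \<and> n * S * b + \<mu> * P1 * d = 0 \<and>
      t * (n * S * a + \<mu> * P1 * c) - (sin \<theta>)\<^sup>2 * \<mu> * P2 * c = 0) \<longleftrightarrow>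
    n * b * c - a * d = 0 \<and> n * P - t * P1 = 0 \<and> S * a + \<mu> * P1 * c = 0"
    (is "?E1 \<and> ?E2 \<and> ?E3 \<longleftrightarrow> ?f \<and> ?g \<and> ?E1")
  proof (intro iffI conjI)
    assume E: "?E1 \<and> ?E2 \<and> ?E3"
    \<comment> \<open>This is \<open>c\<close> times the second equation minus \<open>d\<close>
      times the first.\<close>
    then have "S * (n * b * c - a * d) = 0" by algebra
    then show f0: ?f using \<open>S \<noteq> 0\<close> by simp
    \<comment> \<open>Once \<open>ode\<close> has removed \<open>P2\<close>, the third equation
      minus \<open>n * t\<close> times the first is exactly this product.\<close>
    have "(n + 1) * \<mu> * c * (n * P - t * P1) = 0" using E ode by algebra
    moreover have "c \<noteq> 0" using c0 f0 f by simp
    ultimately show ?g using \<open>n + 1 \<noteq> 0\<close> assms(1) by simp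
    show ?E1 using E by blast
  next
    assume E: "?f \<and> ?g \<and> ?E1"
    \<comment> \<open>Because of \<open>?f\<close> this product equals \<open>d\<close> times the
      first equation.\<close>
    then have "c * (n * S * b + \<mu> * P1 * d) = 0" by algebra
    moreover have "c \<noteq> 0" using c0 E f by simp
    ultimately show ?E2 by simp
    show ?E3 using E ode by algebra
    show ?E1 using E by blast
  qed
  then show ?thesis
    using critical_zero_sph_iff[OF r, of \<theta> \<alpha> \<mu> \<phi>] assms(2)
    unfolding f g by (simp add: S_def n_def t_def P1_def P2_def a_def b_def c_def d_def mult.assoc)
qed

lemma sin_phi_nonzero:
  assumes "j \<in> {1..2 * r - 1}"
  shows "sin (2 * real r * phi r \<alpha> j) \<noteq> 0" "sin (phi r \<alpha> j - \<alpha>) \<noteq> 0"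
  using sin_nonzero_between_grid[OF r] phi_zero[OF r \<alpha> assms]
    meridian_fun_zero_sin_nonzero[OF r \<alpha>] by blast+

lemma critical_zero_exists_at_mu:
  assumes i: "i \<in> {1..r - 1}" and j: "j \<in> {1..2 * r - 1}" and "\<mu> = mu r \<alpha> i j"
  shows "\<mu> > 0" and "\<exists>p. critical_zero (H r \<alpha> \<mu>) p"
proof -
  define w f where "w = omega r i" and "f = phi r \<alpha> j"
  let ?q = "pderiv (legendre_poly (2 * r))"
  have w: "0 < w" "w < pi / 2" "poly (legendre_defect (2 * r)) (cos w) = 0"
    using omega_enum(1,2)[OF r i] by (auto simp: w_def)
  then have sw: "0 < sin w" by (intro sin_gt_zero) auto
  have q: "poly ?q (cos w) \<noteq> 0"
    using pderiv_legendre_poly_nonzero_at_defect_root[of "2 * r"] w(3) r by simp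
  have sf: "sin (2 * real r * f) \<noteq> 0" "sin (f - \<alpha>) \<noteq> 0" using sin_phi_nonzero[OF j] by (simp_all add: f_def)
  define c where "c = sin w ^ (2 * r - 1) * sin (2 * real r * f) / (poly ?q (cos w) * sin (f - \<alpha>))"
  have mu: "\<mu> = \<bar>c\<bar>" using assms(3) by (simp add: mu_def c_def w_def f_def)
  have "c \<noteq> 0" using sw q sf by (simp add: c_def)
  then show pos: "\<mu> > 0" by (simp add: mu)
  have ceq: "sin w ^ (2 * r - 1) * sin (2 * real r * f) = c * poly ?q (cos w) * sin (f - \<alpha>)"
    using q sf by (simp add: c_def)
  \<comment> \<open>At colatitude \<open>w\<close> the last equation holds with parameter
    \<open>- c\<close>, at \<open>pi - w\<close> with parameter \<open>c\<close>; the positive one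
    of the two is \<open>\<mu>\<close>.\<close>
  define \<theta> where "\<theta> = (if c < 0 then w else pi - w)"
  have \<theta>: "sin \<theta> = sin w" "cos \<theta> = (if c < 0 then cos w else - cos w)" by (simp_all add: \<theta>_def)
  have "poly (legendre_defect (2 * r)) (- x) = poly (legendre_defect (2 * r)) x" for x
    by (simp add: poly_legendre_defect legendre_poly_minus pderiv_legendre_poly_minus)
  then have "poly (legendre_defect (2 * r)) (cos \<theta>) = 0" using w(3) \<theta>(2) by simp
  moreover have "\<mu> * poly ?q (cos \<theta>) = - c * poly ?q (cos w)"
    using \<theta>(2) mu by (simp add: pderiv_legendre_poly_minus)
  then have "sin \<theta> ^ (2 * r - 1) * sin (2 * real r * f) + \<mu> * poly ?q (cos \<theta>) * sin (f - \<alpha>) = 0"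
    using ceq \<theta>(1) by simp
  moreover have "meridian_fun r \<alpha> f = 0" using phi_zero(3)[OF r \<alpha> j] by (simp add: f_def)
  ultimately have "critical_zero (H r \<alpha> \<mu>) (sph \<theta> f)"
    using critical_zero_sph_separated[OF pos, of \<theta> f] sw \<theta>(1) by simp
  then show "\<exists>p. critical_zero (H r \<alpha> \<mu>) p" by blast
qed

text \<open>Besides identifying \<open>\<mu>\<close>, this confines the critical zeros to finitely
  many points that are the same for all \<open>\<mu>\<close>, from which finiteness follows.\<close>

lemma critical_zero_location:
  assumes "\<mu> > 0" "critical_zero (H r \<alpha> \<mu>) p"
  obtains i j \<theta> \<phi> where "i \<in> {1..r - 1}" "j \<in> {1..2 * r - 1}" "\<theta> \<in> {omega r i, pi - omega r i}"
    "\<phi> \<in> {phi r \<alpha> j, phi r \<alpha> j + pi}" "p = sph \<theta> \<phi>" "\<mu> = mu r \<alpha> i j"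
proof -
  have "p \<in> S2" using assms(2) by (simp add: critical_zero_def)
  then obtain \<theta> \<phi> where \<theta>: "0 \<le> \<theta>" "\<theta> \<le> pi" and \<phi>: "0 \<le> \<phi>" "\<phi> < 2 * pi" and p: "p = sph \<theta> \<phi>"
    by (rule S2_sph)
  let ?q = "pderiv (legendre_poly (2 * r))" and ?g = "legendre_defect (2 * r)"
  have "sin \<theta> \<noteq> 0" using not_critical_zero_pole[OF r assms(1)] assms(2) p by blast
  then have s: "0 < sin \<theta>" using sin_ge_zero[OF \<theta>] by simp
  have E: "meridian_fun r \<alpha> \<phi> = 0" "poly ?g (cos \<theta>) = 0"
    "sin \<theta> ^ (2 * r - 1) * sin (2 * real r * \<phi>) + \<mu> * poly ?q (cos \<theta>) * sin (\<phi> - \<alpha>) = 0"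
    using assms(2) critical_zero_sph_separated[OF assms(1) s, of \<phi>] p by simp_all
  have geven: "poly ?g (- x) = poly ?g x" for x
    by (simp add: poly_legendre_defect legendre_poly_minus pderiv_legendre_poly_minus)
  have "cos \<theta> \<noteq> 0" using E(2) legendre_poly_even_nonzero_0[of "2 * r"] r
    by (auto simp: poly_legendre_defect)
  moreover have "(cos \<theta>)\<^sup>2 < 1" using s sin_cos_squared_add[of \<theta>] zero_less_power[of "sin \<theta>" 2] by linarith
  then have "\<bar>cos \<theta>\<bar> < 1" by (simp add: abs_square_less_1)
  moreover have "poly ?g \<bar>cos \<theta>\<bar> = 0" using E(2) geven by (simp add: abs_if)
  ultimately obtain i where i: "i \<in> {1..r - 1}" "omega r i = arccos \<bar>cos \<theta>\<bar>"
    using omega_enum(3)[OF r, of "\<bar>cos \<theta>\<bar>"] by auto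
  have \<theta>i: "\<theta> \<in> {omega r i, pi - omega r i}"
  proof (cases "cos \<theta> \<ge> 0")
    case True
    then show ?thesis using i(2) arccos_cos[OF \<theta>] by simp
  next
    case False
    then have "omega r i = arccos (- cos \<theta>)" using i(2) by simp
    also have "\<dots> = pi - \<theta>" using arccos_minus[of "cos \<theta>"] arccos_cos[OF \<theta>] by simp
    finally show ?thesis by simp
  qed
  obtain j where j: "j \<in> {1..2 * r - 1}" and \<phi>j: "\<phi> = phi r \<alpha> j \<or> \<phi> = phi r \<alpha> j + pi"
    using meridian_fun_zeros[OF r \<alpha> \<phi> E(1)] by blast
  \<comment> \<open>A shift by \<open>pi\<close> moves \<open>2 * r * \<phi>\<close> by a multiple
    of \<open>2 * pi\<close> and only flips the sign of \<open>sin (\<phi> - \<alpha>)\<close>, so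
    opposite meridians give the same value \<open>mu\<close>.\<close>
  have sp: "\<bar>sin (2 * real r * \<phi>)\<bar> = \<bar>sin (2 * real r * phi r \<alpha> j)\<bar>"
      "\<bar>sin (\<phi> - \<alpha>)\<bar> = \<bar>sin (phi r \<alpha> j - \<alpha>)\<bar>"
  proof -
    have "2 * real r * (phi r \<alpha> j + pi) = 2 * real r * phi r \<alpha> j + 2 * real r * pi"
      by (simp add: algebra_simps)
    then have "sin (2 * real r * (phi r \<alpha> j + pi)) = sin (2 * real r * phi r \<alpha> j)"
      by (simp add: sin_add)
    then show "\<bar>sin (2 * real r * \<phi>)\<bar> = \<bar>sin (2 * real r * phi r \<alpha> j)\<bar>" using \<phi>j by metis
    have "sin (phi r \<alpha> j + pi - \<alpha>) = - sin (phi r \<alpha> j - \<alpha>)"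
      using sin_periodic_pi[of "phi r \<alpha> j - \<alpha>"] by (simp add: algebra_simps)
    then show "\<bar>sin (\<phi> - \<alpha>)\<bar> = \<bar>sin (phi r \<alpha> j - \<alpha>)\<bar>" using \<phi>j by (metis abs_minus_cancel)
  qed
  have st: "sin (omega r i) = sin \<theta>" using \<theta>i by auto
  have qt: "\<bar>poly ?q (cos (omega r i))\<bar> = \<bar>poly ?q (cos \<theta>)\<bar>"
  proof -
    have "cos \<theta> = cos (omega r i) \<or> cos \<theta> = - cos (omega r i)" using \<theta>i by auto
    then show ?thesis by (auto simp: pderiv_legendre_poly_minus)
  qed
  have q0: "poly ?q (cos \<theta>) \<noteq> 0"
    using pderiv_legendre_poly_nonzero_at_defect_root[of "2 * r"] E(2) r by simp
  have s0: "sin (\<phi> - \<alpha>) \<noteq> 0" using meridian_fun_zero_sin_nonzero[OF r \<alpha> E(1)] .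
  have "\<mu> * (poly ?q (cos \<theta>) * sin (\<phi> - \<alpha>)) = - (sin \<theta> ^ (2 * r - 1) * sin (2 * real r * \<phi>))"
    using E(3) by (simp add: mult.assoc eq_neg_iff_add_eq_0 add.commute)
  then have "\<mu> = - (sin \<theta> ^ (2 * r - 1) * sin (2 * real r * \<phi>)) / (poly ?q (cos \<theta>) * sin (\<phi> - \<alpha>))"
    by (rule iffD2[OF nonzero_eq_divide_eq, rotated]) (simp add: q0 s0)
  then have "\<bar>\<mu>\<bar> = \<bar>sin \<theta> ^ (2 * r - 1)\<bar> * \<bar>sin (2 * real r * \<phi>)\<bar> / (\<bar>poly ?q (cos \<theta>)\<bar> * \<bar>sin (\<phi> - \<alpha>)\<bar>)"
    by (simp add: abs_mult abs_divide)
  also have "\<dots> = mu r \<alpha> i j" unfolding mu_def st abs_mult abs_divide qt sp ..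
  finally have "\<mu> = mu r \<alpha> i j" using assms(1) by simp
  then show thesis using that i(1) j \<theta>i \<phi>j p by blast
qed

lemma finite_critical_zeros:
  assumes "\<mu> > 0"
  shows "finite {p. critical_zero (H r \<alpha> \<mu>) p}"
proof (rule finite_subset)
  let ?\<Theta> = "\<Union>i\<in>{1..r - 1}. {omega r i, pi - omega r i}"
  let ?\<Phi> = "\<Union>j\<in>{1..2 * r - 1}. {phi r \<alpha> j, phi r \<alpha> j + pi}"
  show "{p. critical_zero (H r \<alpha> \<mu>) p} \<subseteq> (\<lambda>(\<theta>, \<phi>). sph \<theta> \<phi>) ` (?\<Theta> \<times> ?\<Phi>)"
  proof
    fix p assume "p \<in> {p. critical_zero (H r \<alpha> \<mu>) p}"
    then have "critical_zero (H r \<alpha> \<mu>) p" by simp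
    then obtain i j \<theta> \<phi> where "i \<in> {1..r - 1}" "j \<in> {1..2 * r - 1}" "\<theta> \<in> {omega r i, pi - omega r i}"
      "\<phi> \<in> {phi r \<alpha> j, phi r \<alpha> j + pi}" "p = sph \<theta> \<phi>"
      by (rule critical_zero_location[OF assms])
    then show "p \<in> (\<lambda>(\<theta>, \<phi>). sph \<theta> \<phi>) ` (?\<Theta> \<times> ?\<Phi>)"
      by (intro image_eqI[of _ _ "(\<theta>, \<phi>)"]) auto
  qed
qed auto

text \<open>A vanishing cross product would make the gradient a multiple of \<open>p\<close>, hence
  zero on the tangent plane, and the point would be a critical zero.\<close>

lemma nodal_set_H_closed_curves:
  assumes "\<nexists>p. critical_zero (H r \<alpha> \<mu>) p"
  shows "\<exists>\<C>. finite \<C> \<and> disjoint \<C> \<and> (\<forall>C\<in>\<C>. simple_closed_curve C) \<and>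
    nodal_set (H r \<alpha> \<mu>) = \<Union>\<C>"
proof (rule regular_nodal_set_closed_curves[OF has_derivative_H continuous_on_gradH])
  fix p assume p: "p \<in> nodal_set (H r \<alpha> \<mu>)"
  show "cross3 p (gradH r \<alpha> \<mu> p) \<noteq> 0"
  proof
    let ?a = "gradH r \<alpha> \<mu> p"
    assume "cross3 p ?a = 0"
    then have "cross3 p (cross3 p ?a) = 0" by simp
    moreover have "p \<bullet> p = 1" using p by (auto simp: nodal_set_def dot_square_norm)
    ultimately have "?a = (p \<bullet> ?a) *\<^sub>R p" by (simp add: Lagrange)
    then have "?a \<bullet> v = (p \<bullet> ?a) * (p \<bullet> v)" for v by (metis inner_scaleR_left)
    then have "critical_zero (H r \<alpha> \<mu>) p"
      using p unfolding critical_zero_iff_gradient[OF has_derivative_H] by (simp add: nodal_set_def)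
    then show False using assms by blast
  qed
qed

end

theorem lemma3:
  fixes r :: nat and \<epsilon> \<alpha> :: real
  assumes "r \<ge> 1"
    and "0 < \<epsilon>" and "\<epsilon> < 1 / 2"
    and "\<alpha> = \<epsilon> * pi / (2 * real r)"
  shows
    "(\<forall>\<mu>>0. (\<exists>p. critical_zero (H r \<alpha> \<mu>) p) \<longleftrightarrow>
        (\<exists>i\<in>{1..r - 1}. \<exists>j\<in>{1..2 * r - 1}. \<mu> = mu r \<alpha> i j)) \<and>
     (\<forall>i\<in>{1..r - 1}. \<forall>j\<in>{1..2 * r - 1}. finite {p. critical_zero (H r \<alpha> (mu r \<alpha> i j)) p}) \<and>
     (\<forall>\<mu>. 0 < \<mu> \<and> ereal \<mu> < mu_c r \<alpha> \<longrightarrow>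
        \<not> (\<exists>p. critical_zero (H r \<alpha> \<mu>) p) \<and>
        (\<exists>\<C>. finite \<C> \<and> disjoint \<C> \<and> (\<forall>C\<in>\<C>. simple_closed_curve C) \<and>
             nodal_set (H r \<alpha> \<mu>) = \<Union>\<C>))"
proof -
  have \<alpha>: "0 < \<alpha>" "\<alpha> < pi / (2 * real r)"
    using assms by (simp_all add: divide_strict_right_mono)
  note ctx = assms(1) \<alpha>
  have crit: "(\<exists>p. critical_zero (H r \<alpha> \<mu>) p) \<longleftrightarrow>
      (\<exists>i\<in>{1..r - 1}. \<exists>j\<in>{1..2 * r - 1}. \<mu> = mu r \<alpha> i j)" if "\<mu> > 0" for \<mu>
  proof
    assume "\<exists>p. critical_zero (H r \<alpha> \<mu>) p"
    then obtain p where "critical_zero (H r \<alpha> \<mu>) p" by blast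
    then show "\<exists>i\<in>{1..r - 1}. \<exists>j\<in>{1..2 * r - 1}. \<mu> = mu r \<alpha> i j"
      by (rule critical_zero_location[OF ctx that]) blast
  qed (use critical_zero_exists_at_mu(2)[OF ctx] in blast)
  have fin: "finite {p. critical_zero (H r \<alpha> (mu r \<alpha> i j)) p}"
    if "i \<in> {1..r - 1}" "j \<in> {1..2 * r - 1}" for i j
    using finite_critical_zeros[OF ctx] critical_zero_exists_at_mu(1)[OF ctx that] by blast
  have none: "\<not> (\<exists>p. critical_zero (H r \<alpha> \<mu>) p)" if \<mu>: "0 < \<mu>" "ereal \<mu> < mu_c r \<alpha>" for \<mu>
  proof
    assume "\<exists>p. critical_zero (H r \<alpha> \<mu>) p"
    then obtain i j where ij: "i \<in> {1..r - 1}" "j \<in> {1..2 * r - 1}" "\<mu> = mu r \<alpha> i j"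
      using crit[OF \<mu>(1)] by blast
    \<comment> \<open>For \<open>r = 1\<close> there is no such \<open>i\<close>: then
      \<open>mu_c\<close> is infinite and \<open>crit\<close> alone excludes critical zeros.\<close>
    then have "mu_c r \<alpha> \<le> ereal \<mu>"
      unfolding mu_c_def by (intro INF_lower2[OF ij(1)] INF_lower2[OF ij(2)]) simp
    then show False using \<mu>(2) by simp
  qed
  show ?thesis
  proof (intro conjI allI ballI impI; (elim conjE)?)
    fix \<mu> :: real assume \<mu>: "0 < \<mu>" "ereal \<mu> < mu_c r \<alpha>"
    show "\<not> (\<exists>p. critical_zero (H r \<alpha> \<mu>) p)" by (rule none[OF \<mu>])
    show "\<exists>\<C>. finite \<C> \<and> disjoint \<C> \<and> (\<forall>C\<in>\<C>. simple_closed_curve C) \<and> nodal_set (H r \<alpha> \<mu>) = \<Union>\<C>"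
      by (rule nodal_set_H_closed_curves[OF ctx none[OF \<mu>]])
  qed (simp_all only: crit fin)
qed

end
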